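(* Assume that the input-output triple $(A,B,C)$ satisfies the output tracking observability inequality on $[0,T]$, i.e. there exists $\gamma>0$ such that for every $g\in\mathcal Y_C'$ the solution $\varphi$ of the adjoint equation with source $g$ satisfies $$\|g\|_{\mathcal Y_C'}^2\le\gamma\,\|B^{\mathsf T}\varphi\|_{L^2(0,T;\mathbb R^m)}^2 .$$ Then for every target $f\in\mathcal Y_C$ there exists a unique control $u_{\min}\in L^2(0,T;\mathbb R^m)$ of minimal $L^2$-norm among the controls $u$ with $\Lambda_C u=f$ (in particular $\Lambda_C u_{\min}=f$). Moreover, $u_{\min}$ is given by $$u_{\min}(t)=B^{\mathsf T}\widehat\varphi(t),$$ where $\widehat\varphi$ is the solution of the adjoint equation corresponding to the source $\widehat g$, and $\widehat g$ is the unique minimizer over $\mathcal Y_C'$ of the quadratic functional $$J(g):=\frac12\int_0^T|B^{\mathsf T}\varphi(t)|^2\,dt-\langle g,f\rangle_{\mathcal Y_C',\mathcal Y_C},\qquad g\in\mathcal Y_C',$$ in which $\varphi$ is the solution of the adjoint equation with source $g$.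
   Context: Fix $T>0$, integers $1\le m\le n$, $1\le p\le n$, and real matrices $A\in\mathbb R^{n\times n}$, $B\in\mathbb R^{n\times m}$, $C\in\mathbb R^{p\times n}$, with $C$ of full row rank. Let $\mathcal Y_C$ be a fixed real Hilbert space of output trajectories, continuously embedded in $L^2(0,T;\mathbb R^p)$, such that the control-to-output operator $$(\Lambda_C u)(t)=\int_0^t Ce^{A(t-s)}Bu(s)\,ds$$ is well defined and continuous from $L^2(0,T;\mathbb R^m)$ to $\mathcal Y_C$. Thus $\Lambda_C u=Cx$, where $x'=Ax+Bu$, $x(0)=0$. $\mathcal Y_C'$ denotes the dual of $\mathcal Y_C$, with duality pairing $\langle\cdot,\cdot\rangle_{\mathcal Y_C',\mathcal Y_C}$. Adjoint equation with source $g\in\mathcal Y_C'$: $$-\varphi'(t)=A^{\mathsf T}\varphi(t)+C^{\mathsf T}g(t),\quad t\in(0,T),\qquad \varphi(T)=0,$$ understood in the sense of transposition: $C^{\mathsf T}g$ is defined by $\langle C^{\mathsf T}g,v\rangle:=\langle g,Cv\rangle_{\mathcal Y_C',\mathcal Y_C}$, and $\varphi\in L^2(0,T;\mathbb R^n)$ satisfies $$\int_0^T\langle v'(t),\varphi(t)\rangle_{\mathbb R^n}dt=\int_0^T\langle Av(t),\varphi(t)\rangle_{\mathbb R^n}dt+\langle g,Cv\rangle_{\mathcal Y_C',\mathcal Y_C}$$ for every admissible state test function $v$, i.e. every solution of $v'=Av+Bu$, $v(0)=0$, with $u\in L^2(0,T;\mathbb R^m)$ (for which $Cv=\Lambda_Cu\in\mathcal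 Y_C$). Only the observation $B^{\mathsf T}\varphi$ enters the statement; it is uniquely determined by this identity. *)

theory Defs
  imports "HOL-Analysis.Analysis"
begin

abbreviation time_measure :: "real \<Rightarrow> real measure" where
  "time_measure T \<equiv> lebesgue_on {0<..<T}"

text \<open>Elements of \<open>L\<^sup>2(0,T;E)\<close> are handled through representatives: two of them denote the same
  element when they agree \<open>AE\<close> in \<open>time_measure T\<close>.\<close>

definition L2 :: "real \<Rightarrow> (real \<Rightarrow> 'a::euclidean_space) set" where
  "L2 T = {u. u \<in> borel_measurable (time_measure T) \<and>
              integrable (time_measure T) (\<lambda>t. (norm (u t))\<^sup>2)}"

definition L2_norm :: "real \<Rightarrow> (real \<Rightarrow> 'a::euclidean_space) \<Rightarrow> real" where
  "L2_norm T u = sqrt (LINT t|time_measure T. (norm (u t))\<^sup>2)"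

text \<open>The Hilbert space of output trajectories is a type \<open>'y\<close> (of sort \<open>real_inner\<close> and
  \<open>complete_space\<close>) with a map \<open>emb\<close> choosing, for each element, a representative of its image
  in \<open>L\<^sup>2(0,T;\<real>\<^sup>p)\<close>. As a map to equivalence classes, \<open>emb\<close> is linear, injective and bounded.\<close>

definition continuous_embedding ::
  "real \<Rightarrow> ('y::{real_inner,complete_space} \<Rightarrow> real \<Rightarrow> real^'p) \<Rightarrow> bool" where
  "continuous_embedding T emb \<longleftrightarrow>
     (\<forall>y. emb y \<in> L2 T) \<and>
     (\<forall>y z. AE t in time_measure T. emb (y + z) t = emb y t + emb z t) \<and>
     (\<forall>r y. AE t in time_measure T. emb (r *\<^sub>R y) t = r *\<^sub>R emb y t) \<and>
     (\<forall>y. (AE t in time_measure T. emb y t = 0) \<longrightarrow> y = 0) \<and>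
     (\<exists>K. \<forall>y. L2_norm T (emb y) \<le> K * norm y)"

text \<open>The library's \<open>exp\<close> does not apply to \<open>real^'n^'n\<close>, whose type-class multiplication is
  componentwise.\<close>

definition mat_exp :: "real^'n^'n \<Rightarrow> real^'n^'n" where
  "mat_exp M = (\<Sum>k. (1 / fact k) *\<^sub>R (((\<lambda>X. M ** X) ^^ k) (mat 1)))"

definition output_map ::
  "real^'n^'n \<Rightarrow> real^'m^'n \<Rightarrow> real^'n^'p \<Rightarrow> (real \<Rightarrow> real^'m) \<Rightarrow> real \<Rightarrow> real^'p" where
  "output_map A B C u t =
     (LINT s|lebesgue_on {0<..<t}. (C ** mat_exp ((t - s) *\<^sub>R A) ** B) *v u s)"

text \<open>\<open>output_map\<close> is well defined and continuous as a (linear) operator from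
  \<open>L\<^sup>2(0,T;\<real>\<^sup>m)\<close> to \<open>'y\<close>.\<close>

definition output_map_continuous ::
  "real \<Rightarrow> real^'n^'n \<Rightarrow> real^'m^'n \<Rightarrow> real^'n^'p \<Rightarrow>
   ('y::{real_inner,complete_space} \<Rightarrow> real \<Rightarrow> real^'p) \<Rightarrow> bool" where
  "output_map_continuous T A B C emb \<longleftrightarrow>
     (\<exists>K. \<forall>u\<in>L2 T. \<exists>y. (AE t in time_measure T. emb y t = output_map A B C u t) \<and>
                        norm y \<le> K * L2_norm T u)"

text \<open>\<open>v\<close> is the absolutely continuous (Caratheodory) solution of \<open>v' = A v + B u\<close>, \<open>v(0) = 0\<close>,
  and \<open>v'\<close> its almost everywhere derivative; the initial condition is the instance \<open>t = 0\<close> of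
  the integral identity.\<close>

definition state_solution ::
  "real \<Rightarrow> real^'n^'n \<Rightarrow> real^'m^'n \<Rightarrow> (real \<Rightarrow> real^'m) \<Rightarrow>
   (real \<Rightarrow> real^'n) \<Rightarrow> (real \<Rightarrow> real^'n) \<Rightarrow> bool" where
  "state_solution T A B u v v' \<longleftrightarrow>
     v' \<in> L2 T \<and>
     (\<forall>t\<in>{0..T}. v t = (LINT s|lebesgue_on {0<..<t}. v' s)) \<and>
     (AE t in time_measure T. v' t = A *v v t + B *v u t)"

text \<open>Solution by transposition of \<open>- \<phi>' = A\<^sup>T \<phi> + C\<^sup>T g\<close>, \<open>\<phi>(T) = 0\<close>, for \<open>g\<close> in the dual
  space \<open>'y \<Rightarrow>\<^sub>L real\<close>. The element \<open>y\<close> of \<open>'y\<close> is \<open>C v\<close>. In general \<open>\<phi>\<close> is not determined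
  by this identity, only its observation \<open>B\<^sup>T \<phi>\<close> is (almost everywhere).\<close>

definition adjoint_solution ::
  "real \<Rightarrow> real^'n^'n \<Rightarrow> real^'m^'n \<Rightarrow> real^'n^'p \<Rightarrow>
   ('y::{real_inner,complete_space} \<Rightarrow> real \<Rightarrow> real^'p) \<Rightarrow>
   ('y \<Rightarrow>\<^sub>L real) \<Rightarrow> (real \<Rightarrow> real^'n) \<Rightarrow> bool" where
  "adjoint_solution T A B C emb g \<phi> \<longleftrightarrow>
     \<phi> \<in> L2 T \<and>
     (\<forall>u v v' y. u \<in> L2 T \<longrightarrow> state_solution T A B u v v' \<longrightarrow>
        (AE t in time_measure T. emb y t = C *v v t) \<longrightarrow>
        (LINT t|time_measure T. v' t \<bullet> \<phi> t) =
        (LINT t|time_measure T. (A *v v t) \<bullet> \<phi> t) + blinfun_apply g y)"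

definition output_tracking_observable ::
  "real \<Rightarrow> real^'n^'n \<Rightarrow> real^'m^'n \<Rightarrow> real^'n^'p \<Rightarrow>
   ('y::{real_inner,complete_space} \<Rightarrow> real \<Rightarrow> real^'p) \<Rightarrow> bool" where
  "output_tracking_observable T A B C emb \<longleftrightarrow>
     (\<exists>\<gamma>>0. \<forall>g \<phi>. adjoint_solution T A B C emb g \<phi> \<longrightarrow>
        (norm g)\<^sup>2 \<le> \<gamma> * (L2_norm T (\<lambda>t. transpose B *v \<phi> t))\<^sup>2)"

text \<open>The value does not depend on the chosen adjoint solution, since only \<open>B\<^sup>T \<phi>\<close> enters.\<close>

definition dual_functional ::
  "real \<Rightarrow> real^'n^'n \<Rightarrow> real^'m^'n \<Rightarrow> real^'n^'p \<Rightarrow>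
   ('y::{real_inner,complete_space} \<Rightarrow> real \<Rightarrow> real^'p) \<Rightarrow> 'y \<Rightarrow> ('y \<Rightarrow>\<^sub>L real) \<Rightarrow> real" where
  "dual_functional T A B C emb f g =
     (let \<phi> = (SOME \<phi>. adjoint_solution T A B C emb g \<phi>)
      in 1/2 * (LINT t|time_measure T. (norm (transpose B *v \<phi> t))\<^sup>2) - blinfun_apply g f)"

definition tracking_control ::
  "real \<Rightarrow> real^'n^'n \<Rightarrow> real^'m^'n \<Rightarrow> real^'n^'p \<Rightarrow>
   ('y::{real_inner,complete_space} \<Rightarrow> real \<Rightarrow> real^'p) \<Rightarrow> 'y \<Rightarrow> (real \<Rightarrow> real^'m) \<Rightarrow> bool" where
  "tracking_control T A B C emb f u \<longleftrightarrow>
     u \<in> L2 T \<and> (AE t in time_measure T. output_map A B C u t = emb f t)"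

end

theory Submission
  imports Defs
begin

text \<open>
  Write \<open>\<Lambda>\<close> for the control-to-output operator with values in \<open>'y\<close>. Integrating the state equation
  against an adjoint solution \<open>\<phi>\<close> with source \<open>g\<close> cancels the terms with \<open>A\<close>, so that the weak
  adjoint equation says exactly that the inner product of \<open>B\<^sup>T \<phi>\<close> with each control \<open>u\<close> is
  \<open>g (\<Lambda> u)\<close> (\<open>adjoint_solution_iff\<close>): the observation \<open>B\<^sup>T \<phi>\<close> is the Hilbert adjoint \<open>\<Lambda>\<^sup>* g\<close>.
  Hence \<open>J g = \<parallel>\<Lambda>\<^sup>* g\<parallel>\<^sup>2 / 2 - g f\<close>, and observability says that this quadratic functional is coercive.
  It is therefore minimized by some \<open>g_hat\<close>, where its first variation \<open>h (\<Lambda> \<Lambda>\<^sup>* g_hat - f)\<close> vanishes for every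
  functional \<open>h\<close>. Thus \<open>\<Lambda> \<Lambda>\<^sup>* g_hat = f\<close> (\<open>gramian_surjective\<close>), and \<open>u_min = \<Lambda>\<^sup>* g_hat\<close> reaches the
  target. If also \<open>\<Lambda> w = f\<close>, then \<open>w - u_min\<close> lies in the kernel of \<open>\<Lambda>\<close>, which is orthogonal to the range
  of \<open>\<Lambda>\<^sup>*\<close>. Pythagoras gives \<open>\<parallel>w\<parallel>\<^sup>2 = \<parallel>u_min\<parallel>\<^sup>2 + \<parallel>w - u_min\<parallel>\<^sup>2\<close>, hence minimality and uniqueness; coercivity
  gives the uniqueness of \<open>g_hat\<close>.

  Two ingredients need work. The first is the existence of adjoint solutions, that is, of
  \<open>\<Lambda>\<^sup>* g\<close> together with a \<open>\<phi>\<close> that it observes: this is the Riesz representation theorem on \<open>L\<^sup>2(0,T)\<close>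
  (\<open>L2_riesz_representation\<close>), which rests on completeness (\<open>L2_complete\<close>).
  The second is that the variation of constants formula gives the one and only solution of the state
  equation (\<open>mild_state_is_solution\<close>, \<open>state_solution_unique\<close>), so that testing with state solutions
  amounts to testing with controls. The Riesz theorem and the minimization of \<open>J\<close> are both instances
  of \<open>quadratic_functional_stationary_point\<close>.
\<close>

section \<open>Minimization of coercive quadratic functionals\<close>

text \<open>The hypothesis on approximate midpoints \<open>z\<close> is uniform convexity of \<open>J\<close> with respect to \<open>d\<close>:
  \<open>J z\<close> cannot drop below the infimum, so two points whose values are almost minimal are close.\<close>

lemma minimizing_sequence_Cauchy:
  fixes J :: "'a \<Rightarrow> real" and d :: "'a \<Rightarrow> 'a \<Rightarrow> real"
  assumes "x0 \<in> S" and lower: "\<And>x. x \<in> S \<Longrightarrow> b \<le> J x" and "c > 0"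
    and mid: "\<And>x y. x \<in> S \<Longrightarrow> y \<in> S \<Longrightarrow> \<exists>z\<in>S. J z + c * (d x y)\<^sup>2 \<le> (J x + J y) / 2"
  shows "\<exists>X. (\<forall>n. X n \<in> S) \<and> (\<lambda>n. J (X n)) \<longlonglongrightarrow> (INF x\<in>S. J x) \<and>
    (\<forall>e>0. \<exists>N. \<forall>m\<ge>N. \<forall>n\<ge>N. d (X m) (X n) < e)"
proof -
  define I where "I = (INF x\<in>S. J x)"
  have bdd: "bdd_below (J ` S)" using lower by (rule bdd_belowI2)
  have I_le: "I \<le> J x" if "x \<in> S" for x
    unfolding I_def by (rule cINF_lower[OF bdd that])
  have "\<exists>x\<in>S. J x < I + 1 / Suc n" for n
    using cInf_lessD[of "J ` S" "I + 1 / Suc n"] \<open>x0 \<in> S\<close> unfolding I_def by auto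
  then obtain X where X: "\<And>n. X n \<in> S" "\<And>n. J (X n) < I + 1 / Suc n" by metis
  have lim: "(\<lambda>n. J (X n)) \<longlonglongrightarrow> I"
  proof (rule tendsto_sandwich[of "\<lambda>n. I"])
    show "(\<lambda>n. I + 1 / Suc n) \<longlonglongrightarrow> I"
      using tendsto_add[OF tendsto_const[of I] LIMSEQ_inverse_real_of_nat] by (simp add: inverse_eq_divide)
  qed (use I_le X in \<open>auto simp: less_imp_le intro!: always_eventually\<close>)
  have cauchy: "\<exists>N. \<forall>m\<ge>N. \<forall>n\<ge>N. d (X m) (X n) < e" if "e > 0" for e
  proof -
    obtain N :: nat where N: "1 / Suc N < c * e\<^sup>2"
      by (rule nat_approx_posE[of "c * e\<^sup>2"]) (use \<open>c > 0\<close> \<open>e > 0\<close> in auto)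
    have "d (X m) (X n) < e" if mn: "m \<ge> N" "n \<ge> N" for m n
    proof -
      obtain z where z: "z \<in> S" "J z + c * (d (X m) (X n))\<^sup>2 \<le> (J (X m) + J (X n)) / 2"
        using mid[OF X(1) X(1)] by blast
      have "J (X k) < I + 1 / Suc N" if "k \<ge> N" for k
      proof -
        have "1 / Suc k \<le> 1 / Suc N" using that by (simp add: frac_le)
        with X(2)[of k] show ?thesis by (meson add_left_mono less_le_trans)
      qed
      from this[OF mn(1)] this[OF mn(2)]
      have "(J (X m) + J (X n)) / 2 < I + 1 / Suc N" by argo
      then have "c * (d (X m) (X n))\<^sup>2 < c * e\<^sup>2"
        using z(2) I_le[OF z(1)] N by linarith
      then have "(d (X m) (X n))\<^sup>2 < e\<^sup>2" using \<open>c > 0\<close> by simp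
      then show ?thesis by (rule power2_less_imp_less) (use \<open>e > 0\<close> in simp)
    qed
    then show ?thesis by blast
  qed
  show ?thesis using X(1) lim cauchy unfolding I_def by blast
qed

text \<open>For small \<open>r\<close> of the sign opposite to \<open>a\<close> the linear term would dominate and be negative.\<close>

lemma first_variation_zero:
  fixes a b :: real
  assumes "\<And>r. 0 \<le> r * a + r\<^sup>2 * b"
  shows "a = 0"
proof (rule ccontr)
  assume "a \<noteq> 0"
  \<comment> \<open>The parabola is negative at \<open>r = - a / k\<close> for every positive \<open>k > b\<close>.\<close>
  define k where "k = \<bar>b\<bar> + 1"
  have k: "k > 0" "b < k" by (auto simp: k_def)
  have "0 \<le> (- a / k) * a + (- a / k)\<^sup>2 * b" by (rule assms)
  also have "\<dots> = (a / k)\<^sup>2 * (b - k)"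
    using k by (simp add: field_simps power2_eq_square)
  also have "\<dots> < 0"
    using k \<open>a \<noteq> 0\<close> by (intro mult_pos_neg) auto
  finally show False by simp
qed

text \<open>The functional is \<open>J (x + r v) = J x + r (l x v) + r\<^sup>2 (q v)\<close> with \<open>q\<close> comparable to the square of
  the norm \<open>N\<close>. The operations \<open>shift x r v = x + r v\<close> and \<open>diff x y = x - y\<close> are parameters because one
  instance lives on a normed space and the other on the set of representatives of \<open>L\<^sup>2\<close> elements,
  with pointwise operations. A minimizing sequence is Cauchy by the parallelogram identity, its limit is a
  minimizer, and there the first variation vanishes.\<close>

lemma quadratic_functional_stationary_point:
  fixes J q N :: "'a \<Rightarrow> real" and l :: "'a \<Rightarrow> 'a \<Rightarrow> real"
    and shift :: "'a \<Rightarrow> real \<Rightarrow> 'a \<Rightarrow> 'a" and diff :: "'a \<Rightarrow> 'a \<Rightarrow> 'a"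
  assumes "x0 \<in> S"
    and shift: "\<And>x r v. x \<in> S \<Longrightarrow> v \<in> S \<Longrightarrow> shift x r v \<in> S"
    and diff: "\<And>x y. x \<in> S \<Longrightarrow> y \<in> S \<Longrightarrow> diff y x \<in> S"
      "\<And>x y. x \<in> S \<Longrightarrow> y \<in> S \<Longrightarrow> shift x 1 (diff y x) = y"
    and expand: "\<And>x r v. x \<in> S \<Longrightarrow> v \<in> S \<Longrightarrow> J (shift x r v) = J x + r * l x v + r\<^sup>2 * q v"
    and "c > 0" and coercive: "\<And>v. v \<in> S \<Longrightarrow> c * (N v)\<^sup>2 \<le> q v"
    and q_bound: "\<And>v. v \<in> S \<Longrightarrow> q v \<le> M * (N v)\<^sup>2"
    and l_bound: "\<And>x. x \<in> S \<Longrightarrow> \<exists>L. \<forall>v\<in>S. \<bar>l x v\<bar> \<le> L * N v"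
    and lower: "\<And>x. x \<in> S \<Longrightarrow> b \<le> J x"
    and complete: "\<And>X. (\<And>n. X n \<in> S) \<Longrightarrow>
        (\<And>e. e > 0 \<Longrightarrow> \<exists>k. \<forall>m\<ge>k. \<forall>n\<ge>k. N (diff (X m) (X n)) < e) \<Longrightarrow>
        \<exists>x\<in>S. (\<lambda>n. N (diff (X n) x)) \<longlonglongrightarrow> 0"
  shows "\<exists>x\<in>S. \<forall>v\<in>S. l x v = 0"
proof -
  have q_nonneg: "0 \<le> q v" if "v \<in> S" for v
    using order_trans[OF _ coercive[OF that]] \<open>c > 0\<close> by simp
  have "\<exists>z\<in>S. J z + c / 4 * (N (diff x y))\<^sup>2 \<le> (J x + J y) / 2" if xy: "x \<in> S" "y \<in> S" for x y
  proof -
    note d = diff(1)[OF xy(2,1)]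
    \<comment> \<open>The midpoint is \<open>y + (x - y) / 2\<close>; the linear terms cancel and a quarter of \<open>q (x - y)\<close> remains.\<close>
    have "J x = J y + l y (diff x y) + q (diff x y)"
      using expand[OF xy(2) d, of 1] diff(2)[OF xy(2,1)] by simp
    moreover have "J (shift y (1/2) (diff x y)) = J y + 1/2 * l y (diff x y) + 1/4 * q (diff x y)"
      unfolding expand[OF xy(2) d] by (simp add: power2_eq_square)
    ultimately have "J (shift y (1/2) (diff x y)) + c / 4 * (N (diff x y))\<^sup>2 \<le> (J x + J y) / 2"
      using coercive[OF d] by (simp add: field_simps)
    then show ?thesis using shift[OF xy(2) d] by blast
  qed
  then have "\<exists>X. (\<forall>n. X n \<in> S) \<and> (\<lambda>n. J (X n)) \<longlonglongrightarrow> (INF x\<in>S. J x) \<and>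
      (\<forall>e>0. \<exists>k. \<forall>m\<ge>k. \<forall>n\<ge>k. N (diff (X m) (X n)) < e)"
    using \<open>c > 0\<close>
    by (intro minimizing_sequence_Cauchy[where c = "c / 4" and b = b, OF \<open>x0 \<in> S\<close>] lower) simp_all
  then obtain X where X: "\<And>n. X n \<in> S" and lim: "(\<lambda>n. J (X n)) \<longlonglongrightarrow> (INF x\<in>S. J x)"
    and cauchy: "\<forall>e>0. \<exists>k. \<forall>m\<ge>k. \<forall>n\<ge>k. N (diff (X m) (X n)) < e" by blast
  from complete[of X] X cauchy obtain x where x: "x \<in> S" and Nlim: "(\<lambda>n. N (diff (X n) x)) \<longlonglongrightarrow> 0"
    by blast
  obtain L where L: "\<And>v. v \<in> S \<Longrightarrow> \<bar>l x v\<bar> \<le> L * N v" using l_bound[OF x] by blast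
  note d = diff(1)[OF x X]
  have "(\<lambda>n. J x + l x (diff (X n) x) + q (diff (X n) x)) \<longlonglongrightarrow> J x + 0 + 0"
  proof (intro tendsto_add tendsto_const)
    show "(\<lambda>n. l x (diff (X n) x)) \<longlonglongrightarrow> 0"
      by (rule Lim_null_comparison[OF _ tendsto_mult_right_zero[OF Nlim, of L]]) (simp add: L d)
    have "(\<lambda>n. M * (N (diff (X n) x))\<^sup>2) \<longlonglongrightarrow> M * 0\<^sup>2"
      by (intro tendsto_intros Nlim)
    then have "(\<lambda>n. M * (N (diff (X n) x))\<^sup>2) \<longlonglongrightarrow> 0" by simp
    then show "(\<lambda>n. q (diff (X n) x)) \<longlonglongrightarrow> 0"
      by (rule Lim_null_comparison[rotated]) (simp add: q_bound q_nonneg d)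
  qed
  moreover have "J (X n) = J x + l x (diff (X n) x) + q (diff (X n) x)" for n
    using expand[OF x d, of 1 n] diff(2)[OF x X] by simp
  ultimately have "(\<lambda>n. J (X n)) \<longlonglongrightarrow> J x" by simp
  then have Jx: "J x = (INF x\<in>S. J x)" using lim by (rule LIMSEQ_unique)
  have bdd: "bdd_below (J ` S)" using lower by (rule bdd_belowI2)
  have "l x v = 0" if v: "v \<in> S" for v
  proof (rule first_variation_zero)
    fix r
    have "J x \<le> J (shift x r v)"
      unfolding Jx by (rule cINF_lower[OF bdd shift[OF x v]])
    then show "0 \<le> r * l x v + r\<^sup>2 * q v" unfolding expand[OF x v] by simp
  qed
  then show ?thesis using x by blast
qed

section \<open>The Hilbert space of square integrable trajectories\<close>

definition L2_inner :: "real \<Rightarrow> (real \<Rightarrow> 'a::euclidean_space) \<Rightarrow> (real \<Rightarrow> 'a) \<Rightarrow> real" where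
  "L2_inner T u v = (LINT t|time_measure T. u t \<bullet> v t)"

lemma finite_measure_time: "finite_measure (time_measure T)"
  by (rule finite_measure_lebesgue_on) simp

lemma L2_measurable: "u \<in> L2 T \<Longrightarrow> u \<in> borel_measurable (time_measure T)"
  and L2_square_integrable: "u \<in> L2 T \<Longrightarrow> integrable (time_measure T) (\<lambda>t. (norm (u t))\<^sup>2)"
  by (simp_all add: L2_def)

lemma L2_inner_integrable:
  assumes "u \<in> L2 T" "v \<in> L2 T"
  shows "integrable (time_measure T) (\<lambda>t. u t \<bullet> v t)"
proof (rule Bochner_Integration.integrable_bound)
  show "integrable (time_measure T) (\<lambda>t. (norm (u t))\<^sup>2 + (norm (v t))\<^sup>2)"
    using assms by (intro Bochner_Integration.integrable_add L2_square_integrable)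
  show "(\<lambda>t. u t \<bullet> v t) \<in> borel_measurable (time_measure T)"
    using assms[THEN L2_measurable] by measurable
  have "norm (u t \<bullet> v t) \<le> norm ((norm (u t))\<^sup>2 + (norm (v t))\<^sup>2)" for t
  proof -
    have "\<bar>u t \<bullet> v t\<bar> \<le> norm (u t) * norm (v t)" by (rule Cauchy_Schwarz_ineq2)
    also have "\<dots> \<le> (norm (u t))\<^sup>2 + (norm (v t))\<^sup>2"
      using sum_squares_bound[of "norm (u t)" "norm (v t)"]
        mult_nonneg_nonneg[OF norm_ge_zero norm_ge_zero, of "u t" "v t"] by linarith
    finally show ?thesis by simp
  qed
  then show "AE t in time_measure T. norm (u t \<bullet> v t) \<le> norm ((norm (u t))\<^sup>2 + (norm (v t))\<^sup>2)"
    by simp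
qed

lemma L2_dominated:
  fixes u :: "real \<Rightarrow> 'a::euclidean_space" and v :: "real \<Rightarrow> 'b::euclidean_space"
  assumes v: "v \<in> L2 T" and u: "u \<in> borel_measurable (time_measure T)"
    and le: "\<And>t. t \<in> {0<..<T} \<Longrightarrow> norm (u t) \<le> K * norm (v t)"
  shows "u \<in> L2 T"
proof -
  have "integrable (time_measure T) (\<lambda>t. (norm (u t))\<^sup>2)"
  proof (rule Bochner_Integration.integrable_bound)
    show "integrable (time_measure T) (\<lambda>t. K\<^sup>2 * (norm (v t))\<^sup>2)"
      using L2_square_integrable[OF v] by simp
    show "(\<lambda>t. (norm (u t))\<^sup>2) \<in> borel_measurable (time_measure T)"
      using u by measurable
    have "norm ((norm (u t))\<^sup>2) \<le> norm (K\<^sup>2 * (norm (v t))\<^sup>2)" if "t \<in> {0<..<T}" for t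
      using power_mono[OF le[OF that], of 2] by (simp add: power_mult_distrib)
    then show "AE t in time_measure T. norm ((norm (u t))\<^sup>2) \<le> norm (K\<^sup>2 * (norm (v t))\<^sup>2)"
      by (auto intro!: AE_I2)
  qed
  with u show ?thesis by (simp add: L2_def)
qed

lemma L2_const: "(\<lambda>_. c) \<in> L2 T"
  by (simp add: L2_def finite_measure.integrable_const[OF finite_measure_time])

lemma L2_bounded:
  fixes u :: "real \<Rightarrow> 'a::euclidean_space"
  assumes "u \<in> borel_measurable (time_measure T)" "\<And>t. t \<in> {0<..<T} \<Longrightarrow> norm (u t) \<le> K"
  shows "u \<in> L2 T"
  by (rule L2_dominated[OF L2_const[of "1::real"], where K = K]) (use assms in auto)

lemma L2_bounded_linear:
  fixes F :: "'a::euclidean_space \<Rightarrow> 'b::euclidean_space"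
  assumes F: "bounded_linear F" and u: "u \<in> L2 T"
  shows "(\<lambda>t. F (u t)) \<in> L2 T"
proof -
  obtain K where K: "\<And>x. norm (F x) \<le> norm x * K"
    using bounded_linear.bounded[OF F] by blast
  show ?thesis
  proof (rule L2_dominated[OF u, where K = K])
    show "(\<lambda>t. F (u t)) \<in> borel_measurable (time_measure T)"
      using measurable_compose[OF L2_measurable[OF u]] bounded_linear.linear[OF F]
      by (metis borel_measurable_continuous_onI linear_continuous_on F)
  qed (use K in \<open>auto simp: mult.commute\<close>)
qed

lemma L2_add:
  assumes "u \<in> L2 T" "v \<in> L2 T"
  shows "(\<lambda>t. u t + v t) \<in> L2 T"
proof -
  have "integrable (time_measure T) (\<lambda>t. (norm (u t))\<^sup>2 + 2 * (u t \<bullet> v t) + (norm (v t))\<^sup>2)"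
    using assms by (intro Bochner_Integration.integrable_add integrable_mult_right
        L2_square_integrable L2_inner_integrable) auto
  then have "integrable (time_measure T) (\<lambda>t. (norm (u t + v t))\<^sup>2)"
    by (simp add: power2_norm_eq_inner inner_add inner_commute algebra_simps)
  then show ?thesis using assms[THEN L2_measurable] by (simp add: L2_def)
qed

lemma L2_scaleR: "u \<in> L2 T \<Longrightarrow> (\<lambda>t. r *\<^sub>R u t) \<in> L2 T"
  by (rule L2_bounded_linear[OF bounded_linear_scaleR_right])

lemma L2_diff:
  assumes "u \<in> L2 T" "v \<in> L2 T"
  shows "(\<lambda>t. u t - v t) \<in> L2 T"
  using L2_add[OF assms(1) L2_scaleR[OF assms(2), of "-1"]] by simp

lemma L2_integrable:
  fixes u :: "real \<Rightarrow> 'a::euclidean_space"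
  assumes "u \<in> L2 T"
  shows "integrable (time_measure T) u"
proof (rule Bochner_Integration.integrable_bound)
  show "integrable (time_measure T) (\<lambda>t. 1 + (norm (u t))\<^sup>2)"
    using L2_square_integrable[OF assms] finite_measure.integrable_const[OF finite_measure_time]
    by (intro Bochner_Integration.integrable_add)
  have "norm (u t) \<le> norm (1 + (norm (u t))\<^sup>2)" for t
    using sum_squares_bound[of 1 "norm (u t)"] norm_ge_zero[of "u t"] by (simp, linarith)
  then show "AE t in time_measure T. norm (u t) \<le> norm (1 + (norm (u t))\<^sup>2)" by simp
qed (rule L2_measurable[OF assms])

lemma L2_norm_nonneg: "0 \<le> L2_norm T u"
  by (simp add: L2_norm_def Bochner_Integration.integral_nonneg)

lemma L2_norm_square: "(L2_norm T u)\<^sup>2 = L2_inner T u u"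
  by (simp add: L2_norm_def L2_inner_def Bochner_Integration.integral_nonneg power2_norm_eq_inner)

lemma L2_inner_commute: "L2_inner T u v = L2_inner T v u"
  by (simp add: L2_inner_def inner_commute)

lemma L2_inner_add_left:
  "u \<in> L2 T \<Longrightarrow> v \<in> L2 T \<Longrightarrow> w \<in> L2 T \<Longrightarrow>
    L2_inner T (\<lambda>t. u t + v t) w = L2_inner T u w + L2_inner T v w"
  by (simp add: L2_inner_def inner_add_left L2_inner_integrable)

lemma L2_inner_scaleR_left: "L2_inner T (\<lambda>t. r *\<^sub>R u t) w = r * L2_inner T u w"
  by (simp add: L2_inner_def)

lemma L2_inner_diff_left:
  "u \<in> L2 T \<Longrightarrow> v \<in> L2 T \<Longrightarrow> w \<in> L2 T \<Longrightarrow>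
    L2_inner T (\<lambda>t. u t - v t) w = L2_inner T u w - L2_inner T v w"
  by (simp add: L2_inner_def inner_diff_left L2_inner_integrable)

lemma L2_norm_square_add_scaleR:
  assumes "u \<in> L2 T" "v \<in> L2 T"
  shows "(L2_norm T (\<lambda>t. u t + r *\<^sub>R v t))\<^sup>2 =
    (L2_norm T u)\<^sup>2 + 2 * r * L2_inner T u v + r\<^sup>2 * (L2_norm T v)\<^sup>2"
proof -
  note rv = L2_scaleR[OF assms(2), of r]
  note sum = L2_add[OF assms(1) rv]
  show ?thesis
    unfolding L2_norm_square L2_inner_add_left[OF assms(1) rv sum] L2_inner_scaleR_left
      L2_inner_commute[of T _ "\<lambda>t. u t + r *\<^sub>R v t"]
      L2_inner_add_left[OF assms(1) rv assms(1)] L2_inner_add_left[OF assms(1) rv assms(2)]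
    by (simp add: L2_inner_commute[of T v u] algebra_simps power2_eq_square)
qed

lemma L2_norm_square_diff:
  assumes "u \<in> L2 T" "v \<in> L2 T"
  shows "(L2_norm T (\<lambda>t. u t - v t))\<^sup>2 =
    (L2_norm T u)\<^sup>2 - 2 * L2_inner T u v + (L2_norm T v)\<^sup>2"
  using L2_norm_square_add_scaleR[OF assms, of "-1"] by simp

lemma L2_norm_zero_iff:
  assumes "u \<in> L2 T"
  shows "L2_norm T u = 0 \<longleftrightarrow> (AE t in time_measure T. u t = 0)"
  using integral_nonneg_eq_0_iff_AE[OF L2_square_integrable[OF assms]]
  by (simp add: L2_norm_def)

text \<open>The inner product is only positive semidefinite on representatives, hence the separate
  treatment of \<open>L2_norm T v = 0\<close> in the discriminant argument.\<close>

lemma L2_Cauchy_Schwarz: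
  assumes "u \<in> L2 T" "v \<in> L2 T"
  shows "\<bar>L2_inner T u v\<bar> \<le> L2_norm T u * L2_norm T v"
proof -
  have "0 \<le> (L2_norm T u)\<^sup>2 + 2 * r * L2_inner T u v + r\<^sup>2 * (L2_norm T v)\<^sup>2" for r
    unfolding L2_norm_square_add_scaleR[OF assms, symmetric] by simp
  note q = this
  have "(L2_inner T u v)\<^sup>2 \<le> (L2_norm T u)\<^sup>2 * (L2_norm T v)\<^sup>2"
  proof (cases "L2_norm T v = 0")
    case True
    have "2 * L2_inner T u v = 0"
    proof (rule ccontr)
      assume "2 * L2_inner T u v \<noteq> 0"
      moreover define r where "r = - ((L2_norm T u)\<^sup>2 + 1) / (2 * L2_inner T u v)"
      ultimately have "2 * r * L2_inner T u v = - ((L2_norm T u)\<^sup>2 + 1)" by simp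
      then show False using q[of r] True by simp
    qed
    then show ?thesis by simp
  next
    case False
    \<comment> \<open>The minimum of the quadratic polynomial in \<open>r\<close>.\<close>
    define r where "r = - L2_inner T u v / (L2_norm T v)\<^sup>2"
    have rv: "r * (L2_norm T v)\<^sup>2 = - L2_inner T u v"
      using False by (simp add: r_def)
    have "0 \<le> (L2_norm T u)\<^sup>2 + r * L2_inner T u v"
      using q[of r] rv by (simp add: power2_eq_square[of r] mult.assoc)
    then have "0 \<le> ((L2_norm T u)\<^sup>2 + r * L2_inner T u v) * (L2_norm T v)\<^sup>2"
      by (rule mult_nonneg_nonneg) simp
    also have "\<dots> = (L2_norm T u)\<^sup>2 * (L2_norm T v)\<^sup>2 + (r * (L2_norm T v)\<^sup>2) * L2_inner T u v"
      by (simp add: algebra_simps)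
    finally show ?thesis unfolding rv by (simp add: power2_eq_square)
  qed
  then have "(L2_inner T u v)\<^sup>2 \<le> (L2_norm T u * L2_norm T v)\<^sup>2" by (simp add: power_mult_distrib)
  then show ?thesis
    using L2_norm_nonneg abs_le_square_iff by (metis abs_mult abs_of_nonneg)
qed

lemma L2_inner_eq_imp_AE_eq:
  assumes "\<eta> \<in> L2 T" "\<xi> \<in> L2 T" "\<And>u. u \<in> L2 T \<Longrightarrow> L2_inner T \<eta> u = L2_inner T \<xi> u"
  shows "AE t in time_measure T. \<eta> t = \<xi> t"
proof -
  note d = L2_diff[OF assms(1,2)]
  have "(L2_norm T (\<lambda>t. \<eta> t - \<xi> t))\<^sup>2 = 0"
    unfolding L2_norm_square L2_inner_diff_left[OF assms(1,2) d] by (simp add: assms(3)[OF d])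
  then show ?thesis using L2_norm_zero_iff[OF d] by simp
qed

lemma Cauchy_fast_subsequence:
  fixes d :: "nat \<Rightarrow> nat \<Rightarrow> real"
  assumes "\<And>e. e > 0 \<Longrightarrow> \<exists>N. \<forall>m\<ge>N. \<forall>n\<ge>N. d m n < e"
  obtains r :: "nat \<Rightarrow> nat" where "\<And>k. k \<le> r k" "\<And>k. d (r (Suc k)) (r k) < (1 / 2) ^ k"
proof -
  have "\<exists>N. \<forall>m\<ge>N. \<forall>n\<ge>N. d m n < (1 / 2) ^ k" for k :: nat
    by (rule assms) simp
  then obtain N where N: "\<And>k m n. N k \<le> m \<Longrightarrow> N k \<le> n \<Longrightarrow> d m n < (1 / 2) ^ k" by metis
  define r where "r k = k + (\<Sum>i\<le>k. N i)" for k
  have "N k \<le> r k" "N k \<le> r (Suc k)" for k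
    using member_le_sum[of k "{..k}" N] by (simp_all add: r_def)
  with N that[of r] show thesis by (simp add: r_def)
qed

text \<open>On a bounded time interval convergence in \<open>L\<^sup>2\<close> controls convergence in \<open>L\<^sup>1\<close>.\<close>

lemma L2_norm_integral_le:
  assumes "u \<in> L2 T"
  shows "(LINT t|time_measure T. norm (u t)) \<le> L2_norm T u * L2_norm T (\<lambda>_. 1::real)"
proof -
  have nu: "(\<lambda>t. norm (u t)) \<in> L2 T"
    by (rule L2_dominated[OF assms, where K = 1]) (use L2_measurable[OF assms] in auto)
  have "(LINT t|time_measure T. norm (u t)) = L2_inner T (\<lambda>t. norm (u t)) (\<lambda>_. 1)"
    by (simp add: L2_inner_def)
  also have "\<dots> \<le> L2_norm T (\<lambda>t. norm (u t)) * L2_norm T (\<lambda>_. 1::real)"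
    using L2_Cauchy_Schwarz[OF nu L2_const] by (rule order_trans[OF abs_ge_self])
  finally show ?thesis by (simp add: L2_norm_def)
qed

text \<open>The integral of the sum of the norms of the increments is finite by monotone convergence, so this
  sum is finite almost everywhere and the telescoping series of increments converges there.\<close>

lemma AE_convergent_if_summable_increments:
  fixes w :: "nat \<Rightarrow> real \<Rightarrow> 'a::euclidean_space"
  assumes w: "\<And>k. w k \<in> L2 T"
    and inc: "\<And>k. L2_norm T (\<lambda>t. w (Suc k) t - w k t) \<le> (1 / 2) ^ k"
  shows "AE t in time_measure T. convergent (\<lambda>k. w k t)"
proof -
  define d where "d k t = norm (w (Suc k) t - w k t)" for k t
  define K where "K = L2_norm T (\<lambda>_. 1::real)"
  have K: "0 \<le> K" by (simp add: K_def L2_norm_nonneg)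
  have diff: "(\<lambda>t. w (Suc k) t - w k t) \<in> L2 T" for k by (intro L2_diff w)
  have [measurable]: "d k \<in> borel_measurable (time_measure T)" for k
    unfolding d_def using L2_measurable[OF diff] by measurable
  have dint: "(LINT t|time_measure T. d k t) \<le> (1 / 2) ^ k * K" for k
    using L2_norm_integral_le[OF diff, of k] mult_right_mono[OF inc K, of k]
    unfolding d_def K_def by linarith
  have dnn: "(\<integral>\<^sup>+t. d k t \<partial>time_measure T) \<le> ennreal ((1 / 2) ^ k * K)" for k
  proof -
    have "integrable (time_measure T) (d k)"
      unfolding d_def by (intro integrable_norm L2_integrable diff)
    then have "(\<integral>\<^sup>+t. d k t \<partial>time_measure T) = ennreal (LINT t|time_measure T. d k t)"
      by (rule nn_integral_eq_integral) (simp add: d_def)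
    with dint show ?thesis by (simp add: ennreal_leI)
  qed
  have "(\<integral>\<^sup>+t. (\<Sum>k. ennreal (d k t)) \<partial>time_measure T) = (\<Sum>k. \<integral>\<^sup>+t. d k t \<partial>time_measure T)"
    by (rule nn_integral_suminf) measurable
  also have "\<dots> \<le> (\<Sum>k. ennreal ((1 / 2) ^ k * K))"
    by (intro suminf_le dnn) auto
  also have "\<dots> < \<infinity>"
  proof -
    have "summable (\<lambda>k. (1 / 2) ^ k * K)" by (intro summable_mult2 summable_geometric) simp
    then have "(\<Sum>k. ennreal ((1 / 2) ^ k * K)) \<noteq> top"
      by (intro ennreal_suminf_neq_top) (simp_all add: K)
    then show ?thesis by (simp add: top.not_eq_extremum)
  qed
  finally have "AE t in time_measure T. (\<Sum>k. ennreal (d k t)) \<noteq> \<infinity>"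
    by (intro nn_integral_PInf_AE) auto
  then show ?thesis
  proof eventually_elim
    case (elim t)
    then have "summable (\<lambda>k. d k t)"
      by (intro summable_suminf_not_top) (auto simp: d_def)
    then have "summable (\<lambda>k. w (Suc k) t - w k t)"
      unfolding d_def by (rule summable_norm_cancel)
    then have "convergent (\<lambda>n. w 0 t + (\<Sum>k<n. w (Suc k) t - w k t))"
      by (intro convergent_add convergent_const) (simp add: summable_iff_convergent)
    moreover have "w 0 t + (\<Sum>k<n. w (Suc k) t - w k t) = w n t" for n
      by (simp add: sum_lessThan_telescope[of "\<lambda>k. w k t"])
    ultimately show ?case by (simp only:)
  qed
qed

text \<open>Fatou's lemma applied to the squared norms.\<close>

lemma L2_norm_le_AE_limit:
  fixes v :: "nat \<Rightarrow> real \<Rightarrow> 'a::euclidean_space"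
  assumes v: "\<And>k. v k \<in> L2 T" and x: "x \<in> borel_measurable (time_measure T)"
    and lim: "AE t in time_measure T. (\<lambda>k. v k t) \<longlonglongrightarrow> x t"
    and bound: "\<And>k. k \<ge> N \<Longrightarrow> L2_norm T (v k) \<le> e" and "0 \<le> e"
  shows "x \<in> L2 T" "L2_norm T x \<le> e"
proof -
  note [measurable] = L2_measurable[OF v] x
  have nn: "(\<integral>\<^sup>+t. ennreal ((norm (v k t))\<^sup>2) \<partial>time_measure T) \<le> ennreal (e\<^sup>2)" if "k \<ge> N" for k
  proof -
    have "(\<integral>\<^sup>+t. ennreal ((norm (v k t))\<^sup>2) \<partial>time_measure T) = ennreal ((L2_norm T (v k))\<^sup>2)"
      using nn_integral_eq_integral[OF L2_square_integrable[OF v]]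
      by (simp add: L2_norm_def Bochner_Integration.integral_nonneg)
    also have "\<dots> \<le> ennreal (e\<^sup>2)"
      using bound[OF that] by (intro ennreal_leI power_mono L2_norm_nonneg)
    finally show ?thesis .
  qed
  have "(\<integral>\<^sup>+t. ennreal ((norm (x t))\<^sup>2) \<partial>time_measure T)
      \<le> (\<integral>\<^sup>+t. liminf (\<lambda>k. ennreal ((norm (v k t))\<^sup>2)) \<partial>time_measure T)"
  proof (rule nn_integral_mono_AE)
    show "AE t in time_measure T. ennreal ((norm (x t))\<^sup>2) \<le> liminf (\<lambda>k. ennreal ((norm (v k t))\<^sup>2))"
      using lim
    proof eventually_elim
      case (elim t)
      then have "(\<lambda>k. ennreal ((norm (v k t))\<^sup>2)) \<longlonglongrightarrow> ennreal ((norm (x t))\<^sup>2)"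
        by (intro tendsto_ennrealI tendsto_intros)
      then show ?case
        by (intro eq_refl lim_imp_Liminf[symmetric] trivial_limit_sequentially)
    qed
  qed
  also have "\<dots> \<le> liminf (\<lambda>k. \<integral>\<^sup>+t. ennreal ((norm (v k t))\<^sup>2) \<partial>time_measure T)"
    by (rule nn_integral_liminf) measurable
  also have "\<dots> \<le> ennreal (e\<^sup>2)"
    by (rule Liminf_le) (use nn in \<open>auto simp: eventually_at_top_linorder\<close>)
  finally have le: "(\<integral>\<^sup>+t. ennreal ((norm (x t))\<^sup>2) \<partial>time_measure T) \<le> ennreal (e\<^sup>2)" .
  then have int: "integrable (time_measure T) (\<lambda>t. (norm (x t))\<^sup>2)"
    by (intro integrableI_bounded) (auto simp: le_less_trans)
  then show "x \<in> L2 T" using x by (simp add: L2_def)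
  have "(LINT t|time_measure T. (norm (x t))\<^sup>2) \<le> e\<^sup>2"
    using le nn_integral_eq_integral[OF int] by simp
  then show "L2_norm T x \<le> e"
    unfolding L2_norm_def using \<open>0 \<le> e\<close> by (rule real_le_lsqrt[rotated])
qed

text \<open>The Riesz--Fischer theorem. A subsequence with geometrically decreasing increments converges
  almost everywhere; Fatou's lemma turns this into convergence in norm of the whole sequence.\<close>

theorem L2_complete:
  fixes u :: "nat \<Rightarrow> real \<Rightarrow> 'a::euclidean_space"
  assumes u: "\<And>n. u n \<in> L2 T"
    and cauchy: "\<And>e. e > 0 \<Longrightarrow> \<exists>N. \<forall>m\<ge>N. \<forall>n\<ge>N. L2_norm T (\<lambda>t. u m t - u n t) < e"
  obtains w where "w \<in> L2 T" "(\<lambda>n. L2_norm T (\<lambda>t. u n t - w t)) \<longlonglongrightarrow> 0"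
proof -
  obtain r where r: "\<And>k. k \<le> r k"
    "\<And>k. L2_norm T (\<lambda>t. u (r (Suc k)) t - u (r k) t) < (1 / 2) ^ k"
    using Cauchy_fast_subsequence[of "\<lambda>m n. L2_norm T (\<lambda>t. u m t - u n t)", OF cauchy] by blast
  define w where "w t = lim (\<lambda>k. u (r k) t)" for t
  have wm: "w \<in> borel_measurable (time_measure T)"
    unfolding w_def by (intro borel_measurable_lim_metric L2_measurable u)
  have "AE t in time_measure T. convergent (\<lambda>k. u (r k) t)"
    by (rule AE_convergent_if_summable_increments) (use u r in \<open>auto simp: less_imp_le\<close>)
  then have lim: "AE t in time_measure T. (\<lambda>k. u (r k) t) \<longlonglongrightarrow> w t"
    by (simp add: w_def convergent_LIMSEQ_iff)
  have close: "\<exists>N. \<forall>n\<ge>N. (\<lambda>t. u n t - w t) \<in> L2 T \<and> L2_norm T (\<lambda>t. u n t - w t) \<le> e" if "e > 0" for e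
  proof -
    obtain N where N: "\<And>m n. m \<ge> N \<Longrightarrow> n \<ge> N \<Longrightarrow> L2_norm T (\<lambda>t. u m t - u n t) < e"
      using cauchy[OF \<open>e > 0\<close>] by blast
    have "(\<lambda>t. u n t - w t) \<in> L2 T \<and> L2_norm T (\<lambda>t. u n t - w t) \<le> e" if n: "n \<ge> N" for n
    proof -
      have "(\<lambda>t. u n t - w t) \<in> borel_measurable (time_measure T)"
        using wm L2_measurable[OF u] by measurable
      moreover have "AE t in time_measure T. (\<lambda>k. u n t - u (r k) t) \<longlonglongrightarrow> u n t - w t"
        using lim by eventually_elim (intro tendsto_intros)
      moreover have "L2_norm T (\<lambda>t. u n t - u (r k) t) \<le> e" if "k \<ge> N" for k
        using N[OF n] r(1)[of k] that by (simp add: less_imp_le)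
      ultimately show ?thesis
        using L2_norm_le_AE_limit[of "\<lambda>k t. u n t - u (r k) t" T "\<lambda>t. u n t - w t" N e]
          L2_diff[OF u u] \<open>e > 0\<close> by simp
    qed
    then show ?thesis by blast
  qed
  obtain n where "(\<lambda>t. u n t - w t) \<in> L2 T" using close[of 1] by auto
  from L2_diff[OF u[of n] this] have "w \<in> L2 T" by simp
  moreover have "(\<lambda>n. L2_norm T (\<lambda>t. u n t - w t)) \<longlonglongrightarrow> 0"
  proof (rule LIMSEQ_I)
    fix e :: real assume "e > 0"
    then obtain N where "\<forall>n\<ge>N. L2_norm T (\<lambda>t. u n t - w t) \<le> e / 2"
      using close[of "e / 2"] by auto
    then show "\<exists>N. \<forall>n\<ge>N. norm (L2_norm T (\<lambda>t. u n t - w t) - 0) < e"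
      using \<open>e > 0\<close> by (intro exI[of _ N]) (auto simp: L2_norm_nonneg le_less_trans)
  qed
  ultimately show thesis by (rule that)
qed

text \<open>The representing element is the stationary point of \<open>\<parallel>u\<parallel>\<^sup>2 / 2 - F u\<close>.\<close>

theorem L2_riesz_representation:
  fixes F :: "(real \<Rightarrow> 'a::euclidean_space) \<Rightarrow> real"
  assumes add: "\<And>u v. u \<in> L2 T \<Longrightarrow> v \<in> L2 T \<Longrightarrow> F (\<lambda>t. u t + v t) = F u + F v"
    and scale: "\<And>r u. u \<in> L2 T \<Longrightarrow> F (\<lambda>t. r *\<^sub>R u t) = r * F u"
    and bound: "\<And>u. u \<in> L2 T \<Longrightarrow> \<bar>F u\<bar> \<le> K * L2_norm T u"
  shows "\<exists>w\<in>L2 T. \<forall>u\<in>L2 T. L2_inner T w u = F u"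
proof -
  define J where "J u = (L2_norm T u)\<^sup>2 / 2 - F u" for u
  have "\<exists>w\<in>L2 T. \<forall>u\<in>L2 T. L2_inner T w u - F u = 0"
  proof (rule quadratic_functional_stationary_point[where J = J and c = "1/2" and M = "1/2"
        and shift = "\<lambda>u r v t. u t + r *\<^sub>R v t" and diff = "\<lambda>u v t. u t - v t"
        and q = "\<lambda>v. (L2_norm T v)\<^sup>2 / 2" and N = "L2_norm T" and b = "- K\<^sup>2 / 2"])
    show "(\<lambda>_. 0) \<in> L2 T" by (rule L2_const)
  next
    fix u v :: "real \<Rightarrow> 'a" and r assume uv: "u \<in> L2 T" "v \<in> L2 T"
    show "(\<lambda>t. u t + r *\<^sub>R v t) \<in> L2 T" by (intro L2_add L2_scaleR uv)
    show "(\<lambda>t. v t - u t) \<in> L2 T" by (intro L2_diff uv)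
    show "J (\<lambda>t. u t + r *\<^sub>R v t) = J u + r * (L2_inner T u v - F v) + r\<^sup>2 * ((L2_norm T v)\<^sup>2 / 2)"
      unfolding J_def L2_norm_square_add_scaleR[OF uv] add[OF uv(1) L2_scaleR[OF uv(2)]] scale[OF uv(2)]
      by (simp add: algebra_simps)
  next
    fix u :: "real \<Rightarrow> 'a" assume u: "u \<in> L2 T"
    have "\<bar>L2_inner T u v - F v\<bar> \<le> (L2_norm T u + K) * L2_norm T v" if "v \<in> L2 T" for v
      using L2_Cauchy_Schwarz[OF u that] bound[OF that] by (simp add: distrib_right)
    then show "\<exists>L. \<forall>v\<in>L2 T. \<bar>L2_inner T u v - F v\<bar> \<le> L * L2_norm T v" by blast
    have "F u \<le> K * L2_norm T u" using bound[OF u] by simp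
    then show "- K\<^sup>2 / 2 \<le> J u"
      unfolding J_def using sum_squares_bound[of K "L2_norm T u"] by simp
  next
    fix X :: "nat \<Rightarrow> real \<Rightarrow> 'a" assume "\<And>n. X n \<in> L2 T"
      "\<And>e. e > 0 \<Longrightarrow> \<exists>k. \<forall>m\<ge>k. \<forall>n\<ge>k. L2_norm T (\<lambda>t. X m t - X n t) < e"
    then obtain w where "w \<in> L2 T" "(\<lambda>n. L2_norm T (\<lambda>t. X n t - w t)) \<longlonglongrightarrow> 0"
      by (rule L2_complete)
    then show "\<exists>w\<in>L2 T. (\<lambda>n. L2_norm T (\<lambda>t. X n t - w t)) \<longlonglongrightarrow> 0" by blast
  qed auto
  then show ?thesis by simp
qed

section \<open>The matrix exponential\<close>

lemma exponential_series_summable: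
  fixes c :: "nat \<Rightarrow> 'a::banach"
  assumes "\<And>k. norm (c k) \<le> a * b ^ k"
  shows "summable (\<lambda>k. (t ^ k / fact k) *\<^sub>R c k)"
proof (rule summable_comparison_test')
  show "summable (\<lambda>k. a * (inverse (fact k) * (\<bar>t\<bar> * b) ^ k))"
    by (intro summable_mult summable_exp)
  show "norm ((t ^ k / fact k) *\<^sub>R c k) \<le> a * (inverse (fact k) * (\<bar>t\<bar> * b) ^ k)" for k
    using mult_left_mono[OF assms[of k], of "\<bar>t\<bar> ^ k / fact k"]
    by (simp add: power_abs power_mult_distrib field_simps)
qed

text \<open>Each component is a scalar power series that converges everywhere, so it can be differentiated
  term by term; differentiation shifts the coefficient sequence.\<close>

lemma exponential_series_has_vector_derivative:
  fixes c :: "nat \<Rightarrow> 'a::euclidean_space"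
  assumes c: "\<And>k. norm (c k) \<le> a * b ^ k"
  shows "((\<lambda>t. \<Sum>k. (t ^ k / fact k) *\<^sub>R c k) has_vector_derivative
           (\<Sum>k. (t ^ k / fact k) *\<^sub>R c (Suc k))) (at t)"
proof -
  have c': "norm (c (Suc k)) \<le> (a * b) * b ^ k" for k
    using c[of "Suc k"] by (simp add: mult_ac)
  note sm = exponential_series_summable[where c = c, OF c]
    and sm' = exponential_series_summable[where c = "\<lambda>k. c (Suc k)", OF c']
  have "((\<lambda>t. (\<Sum>k. (t ^ k / fact k) *\<^sub>R c k) \<bullet> i) has_derivative
          (\<lambda>h. (h *\<^sub>R (\<Sum>k. (t ^ k / fact k) *\<^sub>R c (Suc k))) \<bullet> i)) (at t)" for i
  proof -
    define d where "d k = (c k \<bullet> i) / fact k" for k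
    have inner_series: "(\<Sum>k. (s ^ k / fact k) *\<^sub>R c k) \<bullet> i = (\<Sum>k. d k * s ^ k)" for s
      using bounded_linear.suminf[OF bounded_linear_inner_left[of i] sm[of s]]
      by (simp add: d_def mult_ac)
    have inner_series': "(\<Sum>k. (t ^ k / fact k) *\<^sub>R c (Suc k)) \<bullet> i = (\<Sum>k. diffs d k * t ^ k)"
    proof -
      have "diffs d k * t ^ k = (t ^ k / fact k) * (c (Suc k) \<bullet> i)" for k
        unfolding diffs_def d_def by (simp add: field_simps del: of_nat_Suc)
      then show ?thesis
        using bounded_linear.suminf[OF bounded_linear_inner_left[of i] sm'[of t]] by simp
    qed
    have "summable (\<lambda>k. d k * s ^ k)" for s
      using bounded_linear.summable[OF bounded_linear_inner_left[of i] sm[of s]]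
      by (simp add: d_def mult_ac)
    then have "((\<lambda>s. \<Sum>k. d k * s ^ k) has_field_derivative (\<Sum>k. diffs d k * t ^ k)) (at t)"
      by (rule termdiffs_strong_converges_everywhere)
    then show ?thesis
      unfolding inner_series by (simp add: has_field_derivative_def inner_series' mult_commute_abs)
  qed
  then show ?thesis
    unfolding has_vector_derivative_def by (subst has_derivative_componentwise_within) auto
qed

lemma bounded_bilinear_matrix_mult: "bounded_bilinear ((**) :: real^'n^'k \<Rightarrow> real^'m^'n \<Rightarrow> _)"
proof (rule bilinear_conv_bounded_bilinear[THEN iffD1])
  have "(X + Y) ** Z = X ** Z + Y ** Z" for X Y :: "real^'n^'k" and Z :: "real^'m^'n"
    by (vector matrix_matrix_mult_def sum.distrib[symmetric] field_simps)
  then show "bilinear ((**) :: real^'n^'k \<Rightarrow> real^'m^'n \<Rightarrow> _)"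
    by (auto simp: bilinear_def matrix_add_ldistrib scalar_matrix_assoc matrix_scalar_ac intro!: linearI)
qed

lemma bounded_bilinear_matrix_vector_mult:
  "bounded_bilinear ((*v) :: real^'n^'k \<Rightarrow> real^'n \<Rightarrow> _)"
  by (rule bilinear_conv_bounded_bilinear[THEN iffD1])
    (auto simp: bilinear_def intro!: linearI
      simp: matrix_vector_right_distrib matrix_vector_mult_add_rdistrib
        scaleR_matrix_vector_assoc matrix_vector_mult_scaleR)

definition mat_pow :: "real^'n^'n \<Rightarrow> nat \<Rightarrow> real^'n^'n" where
  "mat_pow M k = ((\<lambda>X. M ** X) ^^ k) (mat 1)"

lemma mat_pow_0: "mat_pow M 0 = mat 1"
  and mat_pow_Suc: "mat_pow M (Suc k) = M ** mat_pow M k"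
  by (simp_all add: mat_pow_def)

lemma mat_pow_Suc_right: "mat_pow M (Suc k) = mat_pow M k ** M"
  by (induction k) (simp_all add: mat_pow_0 mat_pow_Suc matrix_mul_assoc)

lemma mat_pow_scaleR: "mat_pow (t *\<^sub>R M) k = t ^ k *\<^sub>R mat_pow M k"
  by (induction k) (simp_all add: mat_pow_0 mat_pow_Suc matrix_scalar_ac scalar_matrix_assoc[symmetric] mult_ac)

lemma mat_pow_norm_bound: "\<exists>b. \<forall>k. norm (mat_pow M k) \<le> norm (mat 1 :: real^'n^'n) * b ^ k"
  for M :: "real^'n^'n"
proof -
  obtain K where K: "0 < K" "\<And>(X::real^'n^'n) (Y::real^'n^'n). norm (X ** Y) \<le> norm X * norm Y * K"
    using bounded_bilinear.pos_bounded[OF bounded_bilinear_matrix_mult] by blast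
  have "norm (mat_pow M k) \<le> norm (mat 1 :: real^'n^'n) * (norm M * K) ^ k" for k
  proof (induction k)
    case (Suc k)
    have "norm (mat_pow M (Suc k)) \<le> norm (mat_pow M k) * (norm M * K)"
      using K(2)[of M "mat_pow M k"] by (simp add: mat_pow_Suc mult_ac)
    also have "\<dots> \<le> (norm (mat 1 :: real^'n^'n) * (norm M * K) ^ k) * (norm M * K)"
      using Suc K(1) by (intro mult_right_mono) auto
    finally show ?case by (simp add: mult_ac)
  qed (simp add: mat_pow_0)
  then show ?thesis by blast
qed

lemma mat_exp_scaleR: "mat_exp (t *\<^sub>R M) = (\<Sum>k. (t ^ k / fact k) *\<^sub>R mat_pow M k)"
  unfolding mat_exp_def mat_pow_def[symmetric] by (simp add: mat_pow_scaleR)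

lemma mat_exp_0: "mat_exp 0 = mat 1"
proof -
  have "mat_exp (0 *\<^sub>R (mat 1 :: real^'n^'n)) = (\<Sum>k. (0 ^ k / fact k) *\<^sub>R mat_pow (mat 1) k)"
    by (rule mat_exp_scaleR)
  also have "\<dots> = (\<Sum>k\<in>{0}. (0 ^ k / fact k) *\<^sub>R mat_pow (mat 1 :: real^'n^'n) k)"
    by (rule suminf_finite) auto
  finally show ?thesis by (simp add: mat_pow_0)
qed

text \<open>Both forms are needed: verifying the variation of constants formula produces \<open>M e\<^bsup>tM\<^esup>\<close>, deriving it
  from the state equation produces \<open>e\<^bsup>tM\<^esup> M\<close>. They agree because \<open>M\<close> commutes with its powers.\<close>

lemma
  fixes M :: "real^'n^'n"
  shows mat_exp_has_derivative_left:
      "((\<lambda>t. mat_exp (t *\<^sub>R M)) has_vector_derivative M ** mat_exp (t *\<^sub>R M)) (at t)"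
    and mat_exp_has_derivative_right:
      "((\<lambda>t. mat_exp (t *\<^sub>R M)) has_vector_derivative mat_exp (t *\<^sub>R M) ** M) (at t)"
proof -
  obtain b where b: "\<And>k. norm (mat_pow M k) \<le> norm (mat 1 :: real^'n^'n) * b ^ k"
    using mat_pow_norm_bound by blast
  note sm = exponential_series_summable[where c = "mat_pow M", OF b, of t]
  have deriv: "((\<lambda>t. mat_exp (t *\<^sub>R M)) has_vector_derivative
                 (\<Sum>k. (t ^ k / fact k) *\<^sub>R mat_pow M (Suc k))) (at t)"
    unfolding mat_exp_scaleR by (rule exponential_series_has_vector_derivative[OF b])
  have "M ** mat_exp (t *\<^sub>R M) = (\<Sum>k. (t ^ k / fact k) *\<^sub>R mat_pow M (Suc k))"
    unfolding mat_exp_scaleR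
    by (subst bounded_linear.suminf[OF bounded_bilinear.bounded_linear_right[OF bounded_bilinear_matrix_mult] sm])
      (simp add: mat_pow_Suc matrix_scalar_ac scalar_matrix_assoc)
  then show "((\<lambda>t. mat_exp (t *\<^sub>R M)) has_vector_derivative M ** mat_exp (t *\<^sub>R M)) (at t)"
    using deriv by simp
  have "mat_exp (t *\<^sub>R M) ** M = (\<Sum>k. (t ^ k / fact k) *\<^sub>R mat_pow M (Suc k))"
    unfolding mat_exp_scaleR
    by (subst bounded_linear.suminf[OF bounded_bilinear.bounded_linear_left[OF bounded_bilinear_matrix_mult] sm])
      (simp add: mat_pow_Suc_right matrix_scalar_ac scalar_matrix_assoc)
  then show "((\<lambda>t. mat_exp (t *\<^sub>R M)) has_vector_derivative mat_exp (t *\<^sub>R M) ** M) (at t)"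
    using deriv by simp
qed

lemma continuous_mat_exp: "continuous_on UNIV (\<lambda>t. mat_exp (t *\<^sub>R M))"
  by (metis has_vector_derivative_continuous mat_exp_has_derivative_left continuous_at_imp_continuous_on)

section \<open>Volterra integrals\<close>

lemma integral_lebesgue_on_Int:
  fixes f :: "real \<Rightarrow> 'a::euclidean_space"
  assumes "S \<in> sets lebesgue" "R \<in> sets lebesgue"
  shows "(LINT t|lebesgue_on (S \<inter> R). f t) = (LINT t|lebesgue_on S. indicator R t *\<^sub>R f t)"
  using assms by (simp add: integral_restrict_space indicator_inter_arith)

lemma integrable_lebesgue_on_subset:
  fixes f :: "real \<Rightarrow> 'a::euclidean_space"
  assumes "integrable (lebesgue_on S) f" "S \<in> sets lebesgue" "R \<in> sets lebesgue" "R \<subseteq> S"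
  shows "integrable (lebesgue_on R) f"
proof -
  have "integrable lebesgue (\<lambda>t. indicator R t *\<^sub>R (indicator S t *\<^sub>R f t))"
    using assms integrable_restrict_space[of S lebesgue f]
    by (subst integrable_mult_indicator) simp_all
  also have "(\<lambda>t. indicator R t *\<^sub>R (indicator S t *\<^sub>R f t)) = (\<lambda>t. indicator R t *\<^sub>R f t)"
    using \<open>R \<subseteq> S\<close> by (auto simp: fun_eq_iff indicator_def)
  finally show ?thesis using assms by (simp add: integrable_restrict_space)
qed

lemma AE_lebesgue_on_subset:
  assumes "AE t in lebesgue_on S. P t" "S \<in> sets lebesgue" "R \<in> sets lebesgue" "R \<subseteq> S"
  shows "AE t in lebesgue_on R. P t"
  using assms by (auto simp: AE_restrict_space_iff elim: eventually_mono)

lemma integral_derivative_open_interval: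
  fixes G :: "real \<Rightarrow> 'a::euclidean_space"
  assumes "s \<le> t" and G: "\<And>r. (G has_vector_derivative G' r) (at r)" and cont: "continuous_on UNIV G'"
  shows "integrable (lebesgue_on {s<..<t}) G'"
    and "(LINT r|lebesgue_on {s<..<t}. G' r) = G t - G s"
proof -
  have "integrable (lebesgue_on {s..t}) G'"
    by (rule continuous_imp_integrable_real[OF continuous_on_subset[OF cont]]) simp
  then show int: "integrable (lebesgue_on {s<..<t}) G'"
    by (rule integrable_lebesgue_on_subset) auto
  have "(G' has_integral (G t - G s)) {s..t}"
    using fundamental_theorem_of_calculus[OF \<open>s \<le> t\<close>] G has_vector_derivative_at_within by blast
  then have "(G' has_integral (G t - G s)) {s<..<t}" by (simp add: has_integral_Icc_iff_Ioo)
  then show "(LINT r|lebesgue_on {s<..<t}. G' r) = G t - G s"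
    using lebesgue_integral_eq_integral[OF int] by (simp add: integral_unique)
qed

lemma kernel_bounded:
  fixes K :: "real \<Rightarrow> real \<Rightarrow> real^'n^'k"
  assumes "continuous_on UNIV (\<lambda>p. K (fst p) (snd p))"
  shows "\<exists>c\<ge>0. \<forall>r\<in>{0..t}. \<forall>s\<in>{0..t}. \<forall>x. norm (K r s *v x) \<le> c * norm x"
proof -
  have "bounded ((\<lambda>p. K (fst p) (snd p)) ` ({0..t} \<times> {0..t}))"
    by (intro compact_imp_bounded compact_continuous_image continuous_on_subset[OF assms]
        compact_Times compact_Icc) auto
  then obtain b where b: "\<And>r s. r \<in> {0..t} \<Longrightarrow> s \<in> {0..t} \<Longrightarrow> norm (K r s) \<le> b"
    by (force simp: bounded_iff)
  obtain m where m: "m > 0" "\<And>(X::real^'n^'k) x. norm (X *v x) \<le> norm X * norm x * m"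
    using bounded_bilinear.pos_bounded[OF bounded_bilinear_matrix_vector_mult] by blast
  have "norm (K r s *v x) \<le> (\<bar>b\<bar> * m) * norm x" if "r \<in> {0..t}" "s \<in> {0..t}" for r s x
  proof -
    have "norm (K r s) * norm x * m \<le> \<bar>b\<bar> * norm x * m"
      using b[OF that] m(1) by (intro mult_right_mono) auto
    with m(2)[of "K r s" x] show ?thesis by (simp add: mult_ac)
  qed
  then show ?thesis using m(1) by (intro exI[of _ "\<bar>b\<bar> * m"]) auto
qed

lemma borel_measurable_matrix_vector_mult:
  assumes "X \<in> borel_measurable M" "x \<in> borel_measurable M"
  shows "(\<lambda>p. (X p :: real^'n^'k) *v x p) \<in> borel_measurable M"
  by (rule borel_measurable_continuous_Pair[OF assms])
    (intro bounded_bilinear.continuous_on[OF bounded_bilinear_matrix_vector_mult] continuous_intros)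

lemma kernel_integrable:
  fixes K :: "real \<Rightarrow> real^'n^'k"
  assumes K: "continuous_on UNIV K" and h: "integrable (time_measure t) h"
  shows "integrable (time_measure t) (\<lambda>s. K s *v h s)"
proof -
  have "continuous_on UNIV (\<lambda>p::real \<times> real. K (snd p))"
    by (rule continuous_on_compose2[OF K continuous_on_snd[OF continuous_on_id]]) simp
  from kernel_bounded[OF this, of t]
  obtain c where c: "\<And>s x. s \<in> {0..t} \<Longrightarrow> norm (K s *v x) \<le> c * norm x"
    by fastforce
  show ?thesis
  proof (rule Bochner_Integration.integrable_bound)
    show "integrable (time_measure t) (\<lambda>s. c * norm (h s))" using h by simp
    have "K \<in> borel_measurable (time_measure t)"
      using K by (intro continuous_imp_measurable_on_sets_lebesgue continuous_on_subset[OF K]) auto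
    then show "(\<lambda>s. K s *v h s) \<in> borel_measurable (time_measure t)"
      using h by (intro borel_measurable_matrix_vector_mult) auto
    have "norm (K s *v h s) \<le> norm (c * norm (h s))" if "s \<in> {0<..<t}" for s
      using c[of s "h s"] that by auto
    then show "AE s in time_measure t. norm (K s *v h s) \<le> norm (c * norm (h s))"
      by (auto intro!: AE_I2)
  qed
qed

lemma sigma_finite_time: "sigma_finite_measure (time_measure T)"
  by (rule finite_measure.axioms(1)[OF finite_measure_time])

text \<open>The indicator of the triangle \<open>s < r\<close> turns iterated integrals with a variable limit into integrals
  over a product of fixed measure spaces.\<close>

lemma kernel_measurable_pair:
  fixes K :: "real \<Rightarrow> real \<Rightarrow> real^'n^'k"
  assumes K: "continuous_on UNIV (\<lambda>p. K (fst p) (snd p))" and h: "h \<in> borel_measurable (time_measure t)"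
  shows "(\<lambda>p. indicator {p. snd p < fst p} p *\<^sub>R (K (fst p) (snd p) *v h (snd p)))
    \<in> borel_measurable (time_measure t \<Otimes>\<^sub>M time_measure t)"
proof -
  have id: "(\<lambda>x. x) \<in> borel_measurable (time_measure t)"
    using id_borel_measurable_lebesgue_on by (simp add: id_def)
  have [measurable]: "fst \<in> borel_measurable (time_measure t \<Otimes>\<^sub>M time_measure t)"
    "snd \<in> borel_measurable (time_measure t \<Otimes>\<^sub>M time_measure t)"
    using measurable_compose[OF measurable_fst id] measurable_compose[OF measurable_snd id] by auto
  have "(\<lambda>p. K (fst p) (snd p)) \<in> borel_measurable (time_measure t \<Otimes>\<^sub>M time_measure t)"
    by (rule borel_measurable_continuous_Pair[OF _ _ K]) measurable
  then have [measurable]: "(\<lambda>p. K (fst p) (snd p) *v h (snd p)) \<in> borel_measurable (time_measure t \<Otimes>\<^sub>M time_measure t)"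
    by (intro borel_measurable_matrix_vector_mult measurable_compose[OF measurable_snd h])
  show ?thesis
    by (simp add: indicator_def if_distribR cong: if_cong) measurable
qed

lemma integral_time_measure_restrict:
  fixes f :: "real \<Rightarrow> 'a::euclidean_space"
  assumes "r \<le> t"
  shows "(LINT s|time_measure r. f s) = (LINT s|time_measure t. indicator {..<r} s *\<^sub>R f s)"
proof -
  have "{0<..<r} = {0<..<t} \<inter> {..<r}" using assms by auto
  then show ?thesis by (simp add: integral_lebesgue_on_Int)
qed

text \<open>Exchange of the order of integration over \<open>0 < s < r < t\<close>. Replacing integration by parts, it is the
  analytic core of the variation of constants formula in both directions.\<close>

lemma Fubini_triangle:
  fixes K :: "real \<Rightarrow> real \<Rightarrow> real^'n^'k"
  assumes K: "continuous_on UNIV (\<lambda>p. K (fst p) (snd p))" and h: "integrable (time_measure t) h"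
  shows "(LINT r|time_measure t. LINT s|time_measure r. K r s *v h s) =
    (LINT s|time_measure t. (LINT r|lebesgue_on {s<..<t}. K r s) *v h s)"
proof -
  let ?M = "time_measure t"
  define f where "f r s = indicator {p. snd p < fst p} (r, s) *\<^sub>R (K r s *v h s)" for r s
  interpret pair_sigma_finite ?M ?M
    by (intro pair_sigma_finite.intro sigma_finite_time)
  obtain c where c: "c \<ge> 0" "\<And>r s x. r \<in> {0..t} \<Longrightarrow> s \<in> {0..t} \<Longrightarrow> norm (K r s *v x) \<le> c * norm x"
    using kernel_bounded[OF K] by blast
  have hm: "h \<in> borel_measurable ?M" using h by simp
  have "integrable (?M \<Otimes>\<^sub>M ?M) (case_prod f)"
  proof (rule Bochner_Integration.integrable_bound)
    have int: "integrable ?M (\<lambda>s. norm (c * norm (h s)))" using h by simp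
    show "integrable (?M \<Otimes>\<^sub>M ?M) (\<lambda>p. c * norm (h (snd p)))"
    proof (rule Fubini_integrable)
      show "(\<lambda>p. c * norm (h (snd p))) \<in> borel_measurable (?M \<Otimes>\<^sub>M ?M)"
        using measurable_compose[OF measurable_snd hm] by measurable
    qed (use int finite_measure.integrable_const[OF finite_measure_time] h in auto)
    show "case_prod f \<in> borel_measurable (?M \<Otimes>\<^sub>M ?M)"
      using kernel_measurable_pair[OF K hm] by (simp add: f_def case_prod_unfold)
    show "AE p in ?M \<Otimes>\<^sub>M ?M. norm (case_prod f p) \<le> norm (c * norm (h (snd p)))"
    proof (rule AE_I2)
      fix p assume "p \<in> space (?M \<Otimes>\<^sub>M ?M)"
      then have "norm (K (fst p) (snd p) *v h (snd p)) \<le> c * norm (h (snd p))"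
        by (intro c(2)) (auto simp: space_pair_measure)
      then show "norm (case_prod f p) \<le> norm (c * norm (h (snd p)))"
        using c(1) by (auto simp: f_def case_prod_unfold indicator_def)
    qed
  qed
  from Fubini_integral[OF this]
  have swap: "(LINT s|?M. LINT r|?M. f r s) = (LINT r|?M. LINT s|?M. f r s)" .
  have "(LINT r|?M. LINT s|time_measure r. K r s *v h s) = (LINT r|?M. LINT s|?M. f r s)"
  proof (rule Bochner_Integration.integral_cong[OF refl])
    fix r assume "r \<in> space ?M"
    then show "(LINT s|time_measure r. K r s *v h s) = (LINT s|?M. f r s)"
      by (subst integral_time_measure_restrict[of r t]) (auto simp: f_def indicator_def intro!: Bochner_Integration.integral_cong)
  qed
  also have "\<dots> = (LINT s|?M. LINT r|?M. f r s)" by (rule swap[symmetric])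
  also have "\<dots> = (LINT s|?M. (LINT r|lebesgue_on {s<..<t}. K r s) *v h s)"
  proof (rule Bochner_Integration.integral_cong[OF refl])
    fix s assume "s \<in> space ?M"
    then have s: "{s<..<t} = {0<..<t} \<inter> {s<..}" by auto
    have "continuous_on UNIV (\<lambda>r. K r s)"
      using continuous_on_compose2[OF K, of UNIV "\<lambda>r. (r, s)"]
      by (simp add: continuous_on_Pair continuous_on_id continuous_on_const)
    then have "integrable (lebesgue_on {s..t}) (\<lambda>r. K r s)"
      by (intro continuous_imp_integrable_real) (auto intro: continuous_on_subset)
    then have int: "integrable (lebesgue_on {s<..<t}) (\<lambda>r. K r s)"
      by (rule integrable_lebesgue_on_subset) auto
    have "(LINT r|?M. f r s) = (LINT r|lebesgue_on {s<..<t}. K r s *v h s)"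
      unfolding s by (subst integral_lebesgue_on_Int)
        (auto simp: f_def indicator_def intro!: Bochner_Integration.integral_cong)
    also have "\<dots> = (LINT r|lebesgue_on {s<..<t}. K r s) *v h s"
      by (rule integral_bounded_linear[OF _ int])
        (rule bounded_bilinear.bounded_linear_left[OF bounded_bilinear_matrix_vector_mult])
    finally show "(LINT r|?M. f r s) = (LINT r|lebesgue_on {s<..<t}. K r s) *v h s" .
  qed
  finally show ?thesis .
qed

text \<open>The integral is bounded in \<open>t\<close> by a multiple of the \<open>L\<^sup>1\<close> norm of \<open>h\<close>; its measurability
  comes from integrating out one variable of a function on the square.\<close>

lemma Volterra_integral_L2:
  fixes K :: "real \<Rightarrow> real \<Rightarrow> real^'n^'k"
  assumes K: "continuous_on UNIV (\<lambda>p. K (fst p) (snd p))" and h: "integrable (time_measure T) h"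
  shows "(\<lambda>t. LINT s|time_measure t. K t s *v h s) \<in> L2 T"
proof -
  let ?M = "time_measure T"
  define f where "f t s = indicator {p. snd p < fst p} (t, s) *\<^sub>R (K t s *v h s)" for t s
  interpret sigma_finite_measure ?M by (rule sigma_finite_time)
  obtain c where c: "c \<ge> 0" "\<And>r s x. r \<in> {0..T} \<Longrightarrow> s \<in> {0..T} \<Longrightarrow> norm (K r s *v x) \<le> c * norm x"
    using kernel_bounded[OF K] by blast
  have eq: "(LINT s|time_measure t. K t s *v h s) = (LINT s|?M. f t s)" if "t \<in> space ?M" for t
    using that by (subst integral_time_measure_restrict[of t T])
      (auto simp: f_def indicator_def intro!: Bochner_Integration.integral_cong)
  have "(\<lambda>t. LINT s|?M. f t s) \<in> borel_measurable ?M"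
    using kernel_measurable_pair[OF K, of h T] h
    by (intro borel_measurable_lebesgue_integral) (simp add: f_def case_prod_unfold)
  then have meas: "(\<lambda>t. LINT s|time_measure t. K t s *v h s) \<in> borel_measurable ?M"
    by (subst measurable_cong[OF eq]) auto
  have "norm (LINT s|time_measure t. K t s *v h s) \<le> (LINT s|?M. c * norm (h s))" if t: "t \<in> {0<..<T}" for t
  proof -
    have "norm (LINT s|?M. f t s) \<le> (LINT s|?M. c * norm (h s))"
    proof (rule Bochner_Integration.integral_norm_bound_integral)
      have ft: "(\<lambda>s. f t s) \<in> borel_measurable ?M"
        using measurable_compose[OF measurable_Pair1'[of t] kernel_measurable_pair[OF K, of h T]] h t
        by (simp add: f_def)
      show bound: "norm (f t s) \<le> c * norm (h s)" if "s \<in> space ?M" for s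
        using c(2)[of t s "h s"] that t c(1) by (auto simp: f_def indicator_def)
      show int: "integrable ?M (\<lambda>s. c * norm (h s))" using h by simp
      show "integrable ?M (\<lambda>s. f t s)"
        by (rule Bochner_Integration.integrable_bound[OF int ft])
          (use bound c(1) in \<open>auto intro!: AE_I2\<close>)
    qed
    then show ?thesis using eq[of t] t by simp
  qed
  with meas show ?thesis by (rule L2_bounded)
qed

section \<open>The state equation\<close>

definition mild_state :: "real^'n^'n \<Rightarrow> real^'m^'n \<Rightarrow> (real \<Rightarrow> real^'m) \<Rightarrow> real \<Rightarrow> real^'n" where
  "mild_state A B u t = (LINT s|time_measure t. mat_exp ((t - s) *\<^sub>R A) *v (B *v u s))"

lemma continuous_on_mat_exp_scaleR:
  "continuous_on S f \<Longrightarrow> continuous_on S (\<lambda>x. mat_exp (f x *\<^sub>R A))"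
  by (rule continuous_on_compose2[OF continuous_mat_exp]) auto

lemma continuous_on_matrix_mult:
  "continuous_on S f \<Longrightarrow> continuous_on S g \<Longrightarrow> continuous_on S (\<lambda>x. (f x :: real^'n^'k) ** (g x :: real^'m^'n))"
  by (rule bounded_bilinear.continuous_on[OF bounded_bilinear_matrix_mult])

lemma L2_matrix_vector_mult: "u \<in> L2 T \<Longrightarrow> (\<lambda>t. (M :: real^'n^'k) *v u t) \<in> L2 T"
  by (rule L2_bounded_linear) auto

lemma L2_matrix_vector_integrable:
  assumes "u \<in> L2 T" "t \<le> T"
  shows "integrable (time_measure t) (\<lambda>s. (M :: real^'n^'k) *v u s)"
  by (rule integrable_lebesgue_on_subset[OF L2_integrable[OF L2_matrix_vector_mult[OF assms(1)]]])
    (use \<open>t \<le> T\<close> in auto)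

lemma mild_state_integrand_integrable:
  assumes "u \<in> L2 T" "t \<le> T"
  shows "integrable (time_measure t) (\<lambda>s. mat_exp ((t - s) *\<^sub>R A) *v (B *v u s))"
  by (rule kernel_integrable[OF _ L2_matrix_vector_integrable[OF assms]])
    (intro continuous_on_mat_exp_scaleR continuous_intros)

lemma mild_state_L2:
  assumes "u \<in> L2 T"
  shows "mild_state A B u \<in> L2 T"
  unfolding mild_state_def
  by (rule Volterra_integral_L2[OF _ L2_matrix_vector_integrable[OF assms order_refl]])
    (intro continuous_on_mat_exp_scaleR continuous_intros)

lemma output_map_eq_mild_state:
  assumes "u \<in> L2 T" "t \<le> T"
  shows "output_map A B C u t = C *v mild_state A B u t"
  unfolding output_map_def mild_state_def
  by (subst integral_bounded_linear[OF _ mild_state_integrand_integrable[OF assms], symmetric])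
    (auto simp: matrix_vector_mul_assoc matrix_mul_assoc)

text \<open>Exchanging the order of integration in the integral of \<open>A x(r)\<close> over \<open>0 < r < t\<close>, where \<open>x\<close> is the mild
  state, leaves the inner integral of \<open>A e\<^bsup>(r-s)A\<^esup>\<close> over \<open>r\<close> between \<open>s\<close> and \<open>t\<close>, which is \<open>e\<^bsup>(t-s)A\<^esup> - 1\<close>.\<close>

lemma mild_state_is_solution:
  assumes u: "u \<in> L2 T"
  shows "state_solution T A B u (mild_state A B u) (\<lambda>t. A *v mild_state A B u t + B *v u t)"
  unfolding state_solution_def
proof (intro conjI ballI)
  show "(\<lambda>t. A *v mild_state A B u t + B *v u t) \<in> L2 T"
    by (intro L2_add L2_matrix_vector_mult mild_state_L2 u)
next
  fix t assume t: "t \<in> {0..T}"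
  note h = L2_matrix_vector_integrable[OF u, of t B]
  have "(LINT r|time_measure t. A *v mild_state A B u r)
      = (LINT r|time_measure t. LINT s|time_measure r. (A ** mat_exp ((r - s) *\<^sub>R A)) *v (B *v u s))"
  proof (rule Bochner_Integration.integral_cong[OF refl])
    fix r assume "r \<in> space (time_measure t)"
    then have "r \<le> T" using t by auto
    show "A *v mild_state A B u r = (LINT s|time_measure r. (A ** mat_exp ((r - s) *\<^sub>R A)) *v (B *v u s))"
      unfolding mild_state_def
      by (subst integral_bounded_linear[OF _ mild_state_integrand_integrable[OF u \<open>r \<le> T\<close>], symmetric])
        (auto simp: matrix_vector_mul_assoc matrix_mul_assoc)
  qed
  also have "\<dots> = (LINT s|time_measure t. (LINT r|lebesgue_on {s<..<t}. A ** mat_exp ((r - s) *\<^sub>R A)) *v (B *v u s))"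
    by (rule Fubini_triangle)
      (use t h in \<open>auto intro!: continuous_on_matrix_mult continuous_on_mat_exp_scaleR continuous_intros\<close>)
  also have "\<dots> = (LINT s|time_measure t. mat_exp ((t - s) *\<^sub>R A) *v (B *v u s) - B *v u s)"
  proof (rule Bochner_Integration.integral_cong[OF refl])
    fix s assume "s \<in> space (time_measure t)"
    then have "s \<le> t" by auto
    have "((\<lambda>r. r - s) has_vector_derivative 1) (at r)" for r
      unfolding has_real_derivative_iff_has_vector_derivative[symmetric]
      by (auto intro!: derivative_eq_intros)
    from vector_diff_chain_at[OF this mat_exp_has_derivative_left]
    have "((\<lambda>r. mat_exp ((r - s) *\<^sub>R A)) has_vector_derivative A ** mat_exp ((r - s) *\<^sub>R A)) (at r)" for r
      by (simp add: o_def)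
    then have "(LINT r|lebesgue_on {s<..<t}. A ** mat_exp ((r - s) *\<^sub>R A))
        = mat_exp ((t - s) *\<^sub>R A) - mat_exp ((s - s) *\<^sub>R A)"
      by (rule integral_derivative_open_interval(2)[OF \<open>s \<le> t\<close>])
        (intro continuous_on_matrix_mult continuous_on_mat_exp_scaleR continuous_intros)
    then show "(LINT r|lebesgue_on {s<..<t}. A ** mat_exp ((r - s) *\<^sub>R A)) *v (B *v u s)
        = mat_exp ((t - s) *\<^sub>R A) *v (B *v u s) - B *v u s"
      by (simp add: mat_exp_0 matrix_vector_mult_diff_rdistrib)
  qed
  also have "\<dots> = mild_state A B u t - (LINT s|time_measure t. B *v u s)"
    unfolding mild_state_def
    by (rule Bochner_Integration.integral_diff) (use t h mild_state_integrand_integrable[OF u] in auto)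
  finally have "(LINT r|time_measure t. A *v mild_state A B u r)
      = mild_state A B u t - (LINT s|time_measure t. B *v u s)" .
  then show "mild_state A B u t = (LINT r|time_measure t. A *v mild_state A B u r + B *v u r)"
    using t L2_matrix_vector_integrable[OF mild_state_L2[OF u], of t A A B] h
    by (subst Bochner_Integration.integral_add) auto
qed simp

text \<open>In the variation of constants integral, substitute \<open>v' - A v\<close> for \<open>B u\<close> and the integral of \<open>v'\<close> for \<open>v\<close>.
  After exchanging the order of integration, the integral of \<open>e\<^bsup>(t-s)A\<^esup> A\<close> over \<open>s\<close> between \<open>r\<close> and \<open>t\<close> is
  \<open>e\<^bsup>(t-r)A\<^esup> - 1\<close>, the exponentials cancel, and the integral of \<open>v'\<close> remains.\<close>

lemma state_solution_unique:
  assumes u: "u \<in> L2 T" and sol: "state_solution T A B u v v'" and t: "t \<in> {0..T}"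
  shows "v t = mild_state A B u t"
proof -
  have v': "v' \<in> L2 T" and v: "\<And>t. t \<in> {0..T} \<Longrightarrow> v t = (LINT s|time_measure t. v' s)"
    and ode: "AE t in time_measure T. v' t = A *v v t + B *v u t"
    using sol by (auto simp: state_solution_def)
  have v'_int: "integrable (time_measure r) v'" if "r \<le> T" for r
    using L2_matrix_vector_integrable[OF v' that, of "mat 1"] by simp
  have Vint: "(\<lambda>t. LINT s|time_measure t. mat 1 *v v' s) \<in> L2 T"
    by (rule Volterra_integral_L2[OF _ v'_int[OF order_refl]]) simp
  have v_int: "integrable (time_measure t) v"
  proof -
    have "integrable (time_measure T) (\<lambda>t. LINT s|time_measure t. mat 1 *v v' s)"
      by (rule L2_integrable[OF Vint])
    then have "integrable (time_measure T) v"
      by (rule Bochner_Integration.integrable_cong[OF refl, THEN iffD1, rotated]) (simp add: v)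
    then show ?thesis
      by (rule integrable_lebesgue_on_subset) (use t in auto)
  qed
  let ?E = "\<lambda>s. mat_exp ((t - s) *\<^sub>R A)"
  have Ev'_int: "integrable (time_measure t) (\<lambda>s. ?E s *v v' s)"
    by (rule kernel_integrable) (use t v'_int in \<open>auto intro!: continuous_on_mat_exp_scaleR continuous_intros\<close>)
  have Ev_int: "integrable (time_measure t) (\<lambda>s. (?E s ** A) *v v s)"
    by (rule kernel_integrable)
      (use v_int in \<open>auto intro!: continuous_on_matrix_mult continuous_on_mat_exp_scaleR continuous_intros\<close>)
  have "AE s in time_measure t. v' s = A *v v s + B *v u s"
    by (rule AE_lebesgue_on_subset[OF ode]) (use t in auto)
  then have "mild_state A B u t = (LINT s|time_measure t. ?E s *v v' s - (?E s ** A) *v v s)"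
    unfolding mild_state_def
    by (intro integral_cong_AE borel_measurable_integrable mild_state_integrand_integrable[OF u]
        Bochner_Integration.integrable_diff Ev'_int Ev_int)
      (use t in \<open>auto simp: matrix_vector_mul_assoc matrix_vector_right_distrib\<close>)
  also have "\<dots> = (LINT s|time_measure t. ?E s *v v' s) - (LINT s|time_measure t. (?E s ** A) *v v s)"
    by (rule Bochner_Integration.integral_diff[OF Ev'_int Ev_int])
  also have "(LINT s|time_measure t. (?E s ** A) *v v s)
      = (LINT s|time_measure t. LINT r|time_measure s. (?E s ** A) *v v' r)"
  proof (rule Bochner_Integration.integral_cong[OF refl])
    fix s assume "s \<in> space (time_measure t)"
    then have s: "s \<in> {0..T}" using t by auto
    show "(?E s ** A) *v v s = (LINT r|time_measure s. (?E s ** A) *v v' r)"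
      unfolding v[OF s] by (rule integral_bounded_linear[symmetric]) (use s v'_int in auto)
  qed
  also have "\<dots> = (LINT r|time_measure t. (LINT s|lebesgue_on {r<..<t}. ?E s ** A) *v v' r)"
    by (rule Fubini_triangle)
      (use t v'_int in \<open>auto intro!: continuous_on_matrix_mult continuous_on_mat_exp_scaleR continuous_intros\<close>)
  also have "\<dots> = (LINT r|time_measure t. ?E r *v v' r - v' r)"
  proof (rule Bochner_Integration.integral_cong[OF refl])
    fix r assume "r \<in> space (time_measure t)"
    then have "r \<le> t" by auto
    have "((\<lambda>s. t - s) has_vector_derivative - 1) (at s)" for s
      unfolding has_real_derivative_iff_has_vector_derivative[symmetric]
      by (auto intro!: derivative_eq_intros)
    from has_vector_derivative_minus[OF vector_diff_chain_at[OF this mat_exp_has_derivative_right]]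
    have "((\<lambda>s. - ?E s) has_vector_derivative ?E s ** A) (at s)" for s
      by (simp add: o_def)
    then have "(LINT s|lebesgue_on {r<..<t}. ?E s ** A) = (- ?E t) - (- ?E r)"
      by (rule integral_derivative_open_interval(2)[OF \<open>r \<le> t\<close>])
        (intro continuous_on_matrix_mult continuous_on_mat_exp_scaleR continuous_intros)
    then show "(LINT s|lebesgue_on {r<..<t}. ?E s ** A) *v v' r = ?E r *v v' r - v' r"
      by (simp add: mat_exp_0 matrix_vector_mult_diff_rdistrib)
  qed
  also have "\<dots> = (LINT r|time_measure t. ?E r *v v' r) - (LINT r|time_measure t. v' r)"
    by (rule Bochner_Integration.integral_diff[OF Ev'_int v'_int]) (use t in simp)
  finally show ?thesis using v[OF t] by simp
qed

section \<open>Duality between controls and sources\<close>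

locale tracking_system =
  fixes T :: real and A :: "real^'n^'n" and B :: "real^'m^'n" and C :: "real^'n^'p"
    and emb :: "'y::{real_inner,complete_space} \<Rightarrow> real \<Rightarrow> real^'p"
  assumes embedding: "continuous_embedding T emb"
    and continuous_output: "output_map_continuous T A B C emb"
begin

text \<open>The control-to-output operator \<open>\<Lambda>\<close> with values in \<open>'y\<close>.\<close>

definition trajectory :: "(real \<Rightarrow> real^'m) \<Rightarrow> 'y" where
  "trajectory u = (SOME y. AE t in time_measure T. emb y t = output_map A B C u t)"

definition observation :: "(real \<Rightarrow> real^'n) \<Rightarrow> real \<Rightarrow> real^'m" where
  "observation \<phi> = (\<lambda>t. transpose B *v \<phi> t)"

lemma emb_injective:
  assumes "AE t in time_measure T. emb y t = emb z t"
  shows "y = z"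
proof -
  have "AE t in time_measure T. emb (y + (- 1) *\<^sub>R z) t = emb y t + emb ((- 1) *\<^sub>R z) t"
    "AE t in time_measure T. emb ((- 1) *\<^sub>R z) t = (- 1) *\<^sub>R emb z t"
    using embedding by (simp_all only: continuous_embedding_def)
  with assms have "AE t in time_measure T. emb (y + (- 1) *\<^sub>R z) t = 0"
    by eventually_elim simp
  then have "y + (- 1) *\<^sub>R z = 0"
    using embedding by (simp only: continuous_embedding_def)
  then show ?thesis by simp
qed

lemma emb_trajectory:
  assumes "u \<in> L2 T"
  shows "AE t in time_measure T. emb (trajectory u) t = output_map A B C u t"
proof -
  have "\<exists>y. AE t in time_measure T. emb y t = output_map A B C u t"
    using continuous_output assms by (force simp: output_map_continuous_def)
  then show ?thesis unfolding trajectory_def by (rule someI_ex)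
qed

lemma trajectory_eqI:
  assumes "u \<in> L2 T" "AE t in time_measure T. emb y t = output_map A B C u t"
  shows "trajectory u = y"
  using emb_trajectory[OF assms(1)] assms(2) by (intro emb_injective) (auto elim: eventually_elim2)

lemma trajectory_bounded: "\<exists>K\<ge>0. \<forall>u\<in>L2 T. norm (trajectory u) \<le> K * L2_norm T u"
proof -
  obtain K where K: "\<And>u. u \<in> L2 T \<Longrightarrow> \<exists>y. (AE t in time_measure T. emb y t = output_map A B C u t) \<and>
      norm y \<le> K * L2_norm T u"
    using continuous_output by (auto simp: output_map_continuous_def)
  have "norm (trajectory u) \<le> \<bar>K\<bar> * L2_norm T u" if u: "u \<in> L2 T" for u
  proof -
    have "norm (trajectory u) \<le> K * L2_norm T u" using K[OF u] trajectory_eqI[OF u] by blast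
    also have "\<dots> \<le> \<bar>K\<bar> * L2_norm T u" by (intro mult_right_mono L2_norm_nonneg) simp
    finally show ?thesis .
  qed
  then show ?thesis by (intro exI[of _ "\<bar>K\<bar>"]) simp
qed

lemma trajectory_add:
  assumes u: "u \<in> L2 T" and w: "w \<in> L2 T"
  shows "trajectory (\<lambda>t. u t + w t) = trajectory u + trajectory w"
proof (rule trajectory_eqI[OF L2_add[OF u w]])
  have add: "output_map A B C (\<lambda>t. u t + w t) t = output_map A B C u t + output_map A B C w t"
    if "t \<le> T" for t
    unfolding output_map_eq_mild_state[OF u that] output_map_eq_mild_state[OF w that]
      output_map_eq_mild_state[OF L2_add[OF u w] that] matrix_vector_right_distrib[symmetric] mild_state_def
    using mild_state_integrand_integrable[OF u that] mild_state_integrand_integrable[OF w that]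
    by (subst Bochner_Integration.integral_add[symmetric]) (simp_all add: matrix_vector_right_distrib)
  have "AE t in time_measure T. t \<le> T" by (auto intro!: AE_I2)
  moreover have "AE t in time_measure T. emb (trajectory u + trajectory w) t = emb (trajectory u) t + emb (trajectory w) t"
    using embedding by (simp only: continuous_embedding_def)
  ultimately show "AE t in time_measure T. emb (trajectory u + trajectory w) t = output_map A B C (\<lambda>t. u t + w t) t"
    using emb_trajectory[OF u] emb_trajectory[OF w] by eventually_elim (simp add: add)
qed

lemma trajectory_scaleR:
  assumes u: "u \<in> L2 T"
  shows "trajectory (\<lambda>t. r *\<^sub>R u t) = r *\<^sub>R trajectory u"
proof (rule trajectory_eqI[OF L2_scaleR[OF u]])
  have scale: "output_map A B C (\<lambda>t. r *\<^sub>R u t) t = r *\<^sub>R output_map A B C u t" for t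
    unfolding output_map_def by (simp add: matrix_vector_mult_scaleR)
  have "AE t in time_measure T. emb (r *\<^sub>R trajectory u) t = r *\<^sub>R emb (trajectory u) t"
    using embedding by (simp only: continuous_embedding_def)
  then show "AE t in time_measure T. emb (r *\<^sub>R trajectory u) t = output_map A B C (\<lambda>t. r *\<^sub>R u t) t"
    using emb_trajectory[OF u] by eventually_elim (simp add: scale)
qed

lemma tracking_control_iff: "tracking_control T A B C emb f u \<longleftrightarrow> u \<in> L2 T \<and> trajectory u = f"
proof
  assume "tracking_control T A B C emb f u"
  then have u: "u \<in> L2 T" and "AE t in time_measure T. output_map A B C u t = emb f t"
    by (auto simp: tracking_control_def)
  from this(2) have "AE t in time_measure T. emb f t = output_map A B C u t"
    by eventually_elim simp
  with u trajectory_eqI[OF u] show "u \<in> L2 T \<and> trajectory u = f" by simp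
next
  assume u: "u \<in> L2 T \<and> trajectory u = f"
  then have "AE t in time_measure T. emb f t = output_map A B C u t" using emb_trajectory by auto
  then have "AE t in time_measure T. output_map A B C u t = emb f t" by eventually_elim simp
  with u show "tracking_control T A B C emb f u" by (simp add: tracking_control_def)
qed

lemma observation_L2: "\<phi> \<in> L2 T \<Longrightarrow> observation \<phi> \<in> L2 T"
  unfolding observation_def by (rule L2_matrix_vector_mult)

lemma L2_inner_observation: "L2_inner T (observation \<phi>) u = L2_inner T (\<lambda>t. B *v u t) \<phi>"
proof -
  have "(\<phi> t v* B) \<bullet> u t = (B *v u t) \<bullet> \<phi> t" for t
    by (metis dot_lmul_matrix inner_commute)
  then show ?thesis by (simp add: L2_inner_def observation_def transpose_matrix_vector)
qed

text \<open>The only state solution for a control \<open>u\<close> is its mild state, so the terms with \<open>A\<close> on the two sides of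
  the weak equation are equal and finite; what remains of \<open>v'\<close> is \<open>B u\<close>.\<close>

lemma adjoint_solution_iff:
  "adjoint_solution T A B C emb g \<phi> \<longleftrightarrow>
    \<phi> \<in> L2 T \<and> (\<forall>u\<in>L2 T. L2_inner T (observation \<phi>) u = blinfun_apply g (trajectory u))"
proof -
  have weak_form: "((LINT t|time_measure T. v' t \<bullet> \<phi> t) = (LINT t|time_measure T. (A *v v t) \<bullet> \<phi> t) + blinfun_apply g y)
      \<longleftrightarrow> L2_inner T (observation \<phi>) u = blinfun_apply g (trajectory u)"
    if \<phi>: "\<phi> \<in> L2 T" and u: "u \<in> L2 T" and sol: "state_solution T A B u v v'"
      and y: "AE t in time_measure T. emb y t = C *v v t" for u v v' y
  proof -
    let ?x = "mild_state A B u"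
    have v: "v t = ?x t" if "t \<in> {0<..<T}" for t
      using state_solution_unique[OF u sol] that by auto
    have "AE t in time_measure T. t \<in> {0<..<T}" by (rule AE_I2) simp
    with y have "AE t in time_measure T. emb y t = output_map A B C u t"
      by eventually_elim (simp add: v output_map_eq_mild_state[OF u])
    then have y: "trajectory u = y" by (rule trajectory_eqI[OF u])
    have Ax: "(\<lambda>t. A *v ?x t) \<in> L2 T" and Bu: "(\<lambda>t. B *v u t) \<in> L2 T"
      by (intro L2_matrix_vector_mult mild_state_L2 u)+
    have v': "v' \<in> L2 T" and ode: "AE t in time_measure T. v' t = A *v v t + B *v u t"
      using sol by (auto simp: state_solution_def)
    have "AE t in time_measure T. v' t \<bullet> \<phi> t = (A *v ?x t) \<bullet> \<phi> t + (B *v u t) \<bullet> \<phi> t"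
      using ode \<open>AE t in time_measure T. t \<in> {0<..<T}\<close>
      by eventually_elim (simp add: v inner_add_left)
    then have "(LINT t|time_measure T. v' t \<bullet> \<phi> t)
        = (LINT t|time_measure T. (A *v ?x t) \<bullet> \<phi> t + (B *v u t) \<bullet> \<phi> t)"
      using L2_inner_integrable[OF v' \<phi>] L2_inner_integrable[OF Ax \<phi>] L2_inner_integrable[OF Bu \<phi>]
      by (intro integral_cong_AE) auto
    also have "\<dots> = (LINT t|time_measure T. (A *v ?x t) \<bullet> \<phi> t) + L2_inner T (\<lambda>t. B *v u t) \<phi>"
      unfolding L2_inner_def
      by (rule Bochner_Integration.integral_add[OF L2_inner_integrable[OF Ax \<phi>] L2_inner_integrable[OF Bu \<phi>]])
    also have "(LINT t|time_measure T. (A *v ?x t) \<bullet> \<phi> t) = (LINT t|time_measure T. (A *v v t) \<bullet> \<phi> t)"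
      by (intro Bochner_Integration.integral_cong) (auto simp: v)
    finally show ?thesis by (simp add: y L2_inner_observation)
  qed
  show ?thesis
  proof (intro iffI conjI ballI)
    fix u :: "real \<Rightarrow> real^'m" assume adj: "adjoint_solution T A B C emb g \<phi>" and u: "u \<in> L2 T"
    then have \<phi>: "\<phi> \<in> L2 T" by (simp add: adjoint_solution_def)
    have "AE t in time_measure T. t \<in> {0<..<T}" by (rule AE_I2) simp
    with emb_trajectory[OF u] have y: "AE t in time_measure T. emb (trajectory u) t = C *v mild_state A B u t"
      by eventually_elim (simp add: output_map_eq_mild_state[OF u])
    note sol = mild_state_is_solution[OF u, of A B]
    show "L2_inner T (observation \<phi>) u = blinfun_apply g (trajectory u)"
      using adj u sol y weak_form[OF \<phi> u sol y] unfolding adjoint_solution_def by blast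
  next
    assume "\<phi> \<in> L2 T \<and> (\<forall>u\<in>L2 T. L2_inner T (observation \<phi>) u = blinfun_apply g (trajectory u))"
    then show "adjoint_solution T A B C emb g \<phi>"
      unfolding adjoint_solution_def using weak_form by blast
  qed (simp add: adjoint_solution_def)
qed

text \<open>The control acts only through \<open>B u\<close>; this is why every \<open>\<Lambda>\<^sup>* g\<close> takes its values in the range of \<open>B\<^sup>T\<close>.\<close>

lemma trajectory_cong_input:
  assumes "u \<in> L2 T" "w \<in> L2 T" "\<And>t. B *v u t = B *v w t"
  shows "trajectory u = trajectory w"
proof -
  have "output_map A B C u = output_map A B C w"
    unfolding output_map_def by (simp add: matrix_vector_mul_assoc[symmetric] assms(3))
  then show ?thesis by (simp add: trajectory_def)
qed

text \<open>If \<open>B\<close> is not injective, representing \<open>g \<circ> \<Lambda>\<close> on controls would not yet give a function of the form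
  \<open>B\<^sup>T \<phi>\<close>. Choose instead a linear \<open>R\<close> with \<open>B R B = B\<close> and represent \<open>w \<mapsto> g (\<Lambda> (R w))\<close> on state-valued functions
  by \<open>\<phi>\<close>; on \<open>w = B u\<close> the value is \<open>g (\<Lambda> u)\<close>.\<close>

lemma adjoint_solution_exists: "\<exists>\<phi>. adjoint_solution T A B C emb g \<phi>"
proof -
  obtain R :: "real^'n \<Rightarrow> real^'m" where R: "linear R" "\<And>x. B *v R (B *v x) = B *v x"
    using linear_exists_right_inverse_on[OF matrix_vector_mul_linear[of B] subspace_UNIV] by auto
  have RL2: "(\<lambda>t. R (w t)) \<in> L2 T" if "w \<in> L2 T" for w
    by (rule L2_bounded_linear[OF linear_conv_bounded_linear[THEN iffD1, OF R(1)] that])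
  obtain c where c: "\<And>x. norm (R x) \<le> norm x * c"
    using bounded_linear.bounded[OF linear_conv_bounded_linear[THEN iffD1, OF R(1)]] by blast
  obtain K where K: "K \<ge> 0" "\<And>u. u \<in> L2 T \<Longrightarrow> norm (trajectory u) \<le> K * L2_norm T u"
    using trajectory_bounded by blast
  have Rnorm: "L2_norm T (\<lambda>t. R (w t)) \<le> \<bar>c\<bar> * L2_norm T w" if w: "w \<in> L2 T" for w
  proof -
    have "(LINT t|time_measure T. (norm (R (w t)))\<^sup>2) \<le> (LINT t|time_measure T. c\<^sup>2 * (norm (w t))\<^sup>2)"
    proof (intro integral_mono L2_square_integrable RL2 w integrable_mult_right)
      fix t show "(norm (R (w t)))\<^sup>2 \<le> c\<^sup>2 * (norm (w t))\<^sup>2"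
        using power_mono[OF c[of "w t"] norm_ge_zero, of 2] by (simp add: power_mult_distrib mult.commute)
    qed
    then have "(L2_norm T (\<lambda>t. R (w t)))\<^sup>2 \<le> (\<bar>c\<bar> * L2_norm T w)\<^sup>2"
      by (simp add: L2_norm_def power_mult_distrib Bochner_Integration.integral_nonneg)
    then show ?thesis by (rule power2_le_imp_le) (simp add: L2_norm_nonneg)
  qed
  have "\<exists>\<phi>\<in>L2 T. \<forall>w\<in>L2 T. L2_inner T \<phi> w = blinfun_apply g (trajectory (\<lambda>t. R (w t)))"
  proof (rule L2_riesz_representation)
    fix w :: "real \<Rightarrow> real^'n" assume w: "w \<in> L2 T"
    show "blinfun_apply g (trajectory (\<lambda>t. R (r *\<^sub>R w t))) = r * blinfun_apply g (trajectory (\<lambda>t. R (w t)))" for r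
      using trajectory_scaleR[OF RL2[OF w]] by (simp add: linear_cmul[OF R(1)] blinfun.scaleR_right)
    have "\<bar>blinfun_apply g (trajectory (\<lambda>t. R (w t)))\<bar> \<le> norm g * norm (trajectory (\<lambda>t. R (w t)))"
      using norm_blinfun[of g] by simp
    also have "\<dots> \<le> norm g * (K * (\<bar>c\<bar> * L2_norm T w))"
      using K(2)[OF RL2[OF w]] Rnorm[OF w] K(1)
      by (intro mult_left_mono) (auto intro: order_trans mult_left_mono)
    finally show "\<bar>blinfun_apply g (trajectory (\<lambda>t. R (w t)))\<bar> \<le> norm g * K * \<bar>c\<bar> * L2_norm T w"
      by (simp add: mult_ac)
  next
    fix w z :: "real \<Rightarrow> real^'n" assume wz: "w \<in> L2 T" "z \<in> L2 T"
    show "blinfun_apply g (trajectory (\<lambda>t. R (w t + z t)))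
        = blinfun_apply g (trajectory (\<lambda>t. R (w t))) + blinfun_apply g (trajectory (\<lambda>t. R (z t)))"
      using trajectory_add[OF RL2[OF wz(1)] RL2[OF wz(2)]] by (simp add: linear_add[OF R(1)] blinfun.add_right)
  qed
  then obtain \<phi> where \<phi>: "\<phi> \<in> L2 T"
    and repr: "\<And>w. w \<in> L2 T \<Longrightarrow> L2_inner T \<phi> w = blinfun_apply g (trajectory (\<lambda>t. R (w t)))" by blast
  have "L2_inner T (observation \<phi>) u = blinfun_apply g (trajectory u)" if u: "u \<in> L2 T" for u
  proof -
    note Bu = L2_matrix_vector_mult[OF u, of B]
    have "L2_inner T (observation \<phi>) u = blinfun_apply g (trajectory (\<lambda>t. R (B *v u t)))"
      unfolding L2_inner_observation L2_inner_commute[of T _ \<phi>] by (rule repr[OF Bu])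
    also have "trajectory (\<lambda>t. R (B *v u t)) = trajectory u"
      by (rule trajectory_cong_input[OF RL2[OF Bu] u R(2)])
    finally show ?thesis .
  qed
  with \<phi> show ?thesis by (auto simp: adjoint_solution_iff)
qed

text \<open>The Hilbert adjoint \<open>\<Lambda>\<^sup>* g\<close>, through the same choice of an adjoint solution as in
  \<open>dual_functional\<close>.\<close>

definition adjoint_output :: "('y \<Rightarrow>\<^sub>L real) \<Rightarrow> real \<Rightarrow> real^'m" where
  "adjoint_output g = observation (SOME \<phi>. adjoint_solution T A B C emb g \<phi>)"

lemma adjoint_output_L2: "adjoint_output g \<in> L2 T"
  and L2_inner_adjoint_output: "u \<in> L2 T \<Longrightarrow> L2_inner T (adjoint_output g) u = blinfun_apply g (trajectory u)"
  using someI_ex[OF adjoint_solution_exists[of g]]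
  by (auto simp: adjoint_output_def adjoint_solution_iff observation_L2)

lemma observation_adjoint_solution:
  assumes "adjoint_solution T A B C emb g \<phi>"
  shows "AE t in time_measure T. adjoint_output g t = transpose B *v \<phi> t"
  using L2_inner_eq_imp_AE_eq[OF adjoint_output_L2 observation_L2, of \<phi> g] assms
  by (simp add: adjoint_solution_iff L2_inner_adjoint_output observation_def)

lemma dual_functional_eq:
  "dual_functional T A B C emb f g = (L2_norm T (adjoint_output g))\<^sup>2 / 2 - blinfun_apply g f"
  by (simp add: dual_functional_def Let_def adjoint_output_def observation_def L2_norm_def
      Bochner_Integration.integral_nonneg)

text \<open>The output Gramian \<open>\<Lambda> \<Lambda>\<^sup>*\<close>.\<close>

definition gramian :: "('y \<Rightarrow>\<^sub>L real) \<Rightarrow> 'y" where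
  "gramian g = trajectory (adjoint_output g)"

lemma gramian_form: "blinfun_apply g (gramian h) = L2_inner T (adjoint_output g) (adjoint_output h)"
  by (simp add: gramian_def L2_inner_adjoint_output adjoint_output_L2)

lemma gramian_symmetric: "blinfun_apply g (gramian h) = blinfun_apply h (gramian g)"
  by (simp add: gramian_form L2_inner_commute)

lemma gramian_norm_square: "blinfun_apply g (gramian g) = (L2_norm T (adjoint_output g))\<^sup>2"
  by (simp add: gramian_form L2_norm_square)

text \<open>The first variation of the dual functional at \<open>g\<close> in direction \<open>h\<close> is \<open>h (\<Lambda> \<Lambda>\<^sup>* g - f)\<close>.\<close>

lemma dual_functional_shift:
  "dual_functional T A B C emb f (g + r *\<^sub>R h) =
    dual_functional T A B C emb f g + r * blinfun_apply h (gramian g - f)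
      + r\<^sup>2 * ((L2_norm T (adjoint_output h))\<^sup>2 / 2)"
proof -
  have "blinfun_apply (g + r *\<^sub>R h) (gramian (g + r *\<^sub>R h)) =
      blinfun_apply g (gramian g) + 2 * r * blinfun_apply h (gramian g) + r\<^sup>2 * blinfun_apply h (gramian h)"
    using gramian_symmetric[of g "g + r *\<^sub>R h"] gramian_symmetric[of h "g + r *\<^sub>R h"]
      gramian_symmetric[of g h]
    by (simp add: blinfun.add_left blinfun.scaleR_left power2_eq_square algebra_simps)
  then show ?thesis
    unfolding dual_functional_eq gramian_norm_square[symmetric]
    by (simp add: blinfun.add_left blinfun.scaleR_left blinfun.diff_right algebra_simps add_divide_distrib)
qed

text \<open>\<open>\<parallel>\<Lambda>\<^sup>* g\<parallel>\<^sup>2 = g (\<Lambda> \<Lambda>\<^sup>* g) \<le> \<parallel>g\<parallel> K \<parallel>\<Lambda>\<^sup>* g\<parallel>\<close>, where \<open>K\<close> bounds \<open>\<Lambda>\<close>.\<close>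

lemma adjoint_output_bounded: "\<exists>K. \<forall>g. (L2_norm T (adjoint_output g))\<^sup>2 \<le> K * (norm g)\<^sup>2"
proof -
  obtain K where K: "K \<ge> 0" "\<And>u. u \<in> L2 T \<Longrightarrow> norm (trajectory u) \<le> K * L2_norm T u"
    using trajectory_bounded by blast
  have "(L2_norm T (adjoint_output g))\<^sup>2 \<le> K\<^sup>2 * (norm g)\<^sup>2" for g
  proof -
    let ?x = "L2_norm T (adjoint_output g)"
    have "?x\<^sup>2 \<le> norm g * norm (gramian g)"
      unfolding gramian_norm_square[symmetric] using norm_blinfun[of g "gramian g"] by simp
    also have "\<dots> \<le> norm g * (K * ?x)"
      unfolding gramian_def by (intro mult_left_mono K(2) adjoint_output_L2) simp
    finally have "?x * ?x \<le> (K * norm g) * ?x" by (simp add: power2_eq_square mult_ac)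
    then have "?x \<le> K * norm g"
      using L2_norm_nonneg[of T "adjoint_output g"] K(1) by (cases "?x = 0") auto
    from power_mono[OF this L2_norm_nonneg, of 2] show ?thesis by (simp add: power_mult_distrib)
  qed
  then show ?thesis by blast
qed

end

locale observable_tracking_system = tracking_system T A B C emb
  for T :: real and A :: "real^'n^'n" and B :: "real^'m^'n" and C :: "real^'n^'p"
    and emb :: "'y::{real_inner,complete_space} \<Rightarrow> real \<Rightarrow> real^'p" +
  assumes observable: "output_tracking_observable T A B C emb"
begin

lemma observability: "\<exists>\<gamma>>0. \<forall>g. (norm g)\<^sup>2 \<le> \<gamma> * (L2_norm T (adjoint_output g))\<^sup>2"
  using observable someI_ex[OF adjoint_solution_exists]
  unfolding output_tracking_observable_def adjoint_output_def observation_def by blast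

text \<open>Observability makes the dual functional coercive. At a stationary point every functional
  vanishes on \<open>\<Lambda> \<Lambda>\<^sup>* g - f\<close>, in particular the inner product with this vector itself.\<close>

lemma gramian_surjective: "\<exists>g. gramian g = f"
proof -
  obtain \<gamma> where \<gamma>: "\<gamma> > 0" "\<And>g. (norm g)\<^sup>2 \<le> \<gamma> * (L2_norm T (adjoint_output g))\<^sup>2"
    using observability by blast
  obtain K where K: "\<And>g. (L2_norm T (adjoint_output g))\<^sup>2 \<le> K * (norm g)\<^sup>2"
    using adjoint_output_bounded by blast
  \<comment> \<open>Young's inequality absorbs \<open>g f \<le> \<parallel>g\<parallel> \<parallel>f\<parallel>\<close> into a constant plus \<open>\<parallel>g\<parallel>\<^sup>2 / (2 \<gamma>)\<close>, which observability bounds by the quadratic part.\<close>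
  have lower: "- \<gamma> * (norm f)\<^sup>2 / 2 \<le> dual_functional T A B C emb f g" for g
  proof -
    have "blinfun_apply g f \<le> norm g * norm f" using norm_blinfun[of g f] by simp
    moreover have "2 * \<gamma> * (norm g * norm f) \<le> (norm g)\<^sup>2 + \<gamma>\<^sup>2 * (norm f)\<^sup>2"
      using sum_squares_bound[of "norm g" "\<gamma> * norm f"] by (simp add: power_mult_distrib mult_ac)
    ultimately have "2 * \<gamma> * blinfun_apply g f \<le> \<gamma> * (L2_norm T (adjoint_output g))\<^sup>2 + \<gamma>\<^sup>2 * (norm f)\<^sup>2"
      using \<gamma>(2)[of g] mult_left_mono[of "blinfun_apply g f" "norm g * norm f" "2 * \<gamma>"] \<gamma>(1) by linarith
    then have "\<gamma> * (2 * blinfun_apply g f) \<le> \<gamma> * ((L2_norm T (adjoint_output g))\<^sup>2 + \<gamma> * (norm f)\<^sup>2)"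
      by (simp add: algebra_simps power2_eq_square)
    then have "2 * blinfun_apply g f \<le> (L2_norm T (adjoint_output g))\<^sup>2 + \<gamma> * (norm f)\<^sup>2"
      using \<gamma>(1) by simp
    then show ?thesis unfolding dual_functional_eq by simp
  qed
  have "\<exists>g\<in>UNIV. \<forall>h::'y \<Rightarrow>\<^sub>L real\<in>UNIV. blinfun_apply h (gramian g - f) = 0"
  proof (rule quadratic_functional_stationary_point[where J = "dual_functional T A B C emb f"
        and S = UNIV and l = "\<lambda>g h. blinfun_apply h (gramian g - f)"
        and c = "1 / (2 * \<gamma>)" and M = "K / 2" and b = "- \<gamma> * (norm f)\<^sup>2 / 2"
        and shift = "\<lambda>g r h. g + r *\<^sub>R h" and diff = "\<lambda>g h. g - h"
        and q = "\<lambda>g. (L2_norm T (adjoint_output g))\<^sup>2 / 2" and N = norm])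
    fix g :: "'y \<Rightarrow>\<^sub>L real"
    show "1 / (2 * \<gamma>) * (norm g)\<^sup>2 \<le> (L2_norm T (adjoint_output g))\<^sup>2 / 2"
      using \<gamma> by (simp add: field_simps)
    show "(L2_norm T (adjoint_output g))\<^sup>2 / 2 \<le> K / 2 * (norm g)\<^sup>2" using K[of g] by simp
    have "\<bar>blinfun_apply h (gramian g - f)\<bar> \<le> norm (gramian g - f) * norm h" for h :: "'y \<Rightarrow>\<^sub>L real"
      using norm_blinfun[of h "gramian g - f"] by (simp add: mult.commute)
    then show "\<exists>L. \<forall>h\<in>UNIV. \<bar>blinfun_apply h (gramian g - f)\<bar> \<le> L * norm h" by blast
    show "- \<gamma> * (norm f)\<^sup>2 / 2 \<le> dual_functional T A B C emb f g" by (rule lower)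
  next
    fix g h :: "'y \<Rightarrow>\<^sub>L real" and r
    show "dual_functional T A B C emb f (g + r *\<^sub>R h) = dual_functional T A B C emb f g
        + r * blinfun_apply h (gramian g - f) + r\<^sup>2 * ((L2_norm T (adjoint_output h))\<^sup>2 / 2)"
      by (rule dual_functional_shift)
  next
    fix X :: "nat \<Rightarrow> 'y \<Rightarrow>\<^sub>L real"
    assume "\<And>e. e > 0 \<Longrightarrow> \<exists>k. \<forall>m\<ge>k. \<forall>n\<ge>k. norm (X m - X n) < e"
    then have "Cauchy X" by (simp add: Cauchy_iff)
    then obtain g where "X \<longlonglongrightarrow> g" using Cauchy_convergent convergent_def by blast
    then show "\<exists>g\<in>UNIV. (\<lambda>n. norm (X n - g)) \<longlonglongrightarrow> 0"
      by (auto simp: tendsto_norm_zero_iff LIM_zero_iff)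
  next
    show "0 < 1 / (2 * \<gamma>)" using \<gamma>(1) by simp
  qed auto
  then obtain g where "\<And>h :: 'y \<Rightarrow>\<^sub>L real. blinfun_apply h (gramian g - f) = 0" by blast
  from this[of "blinfun_inner_right (gramian g - f)"] show ?thesis by auto
qed

end

theorem theorem3p3:
  fixes T :: real
    and A :: "real^'n^'n" and B :: "real^'m^'n" and C :: "real^'n^'p"
    and emb :: "'y::{real_inner,complete_space} \<Rightarrow> real \<Rightarrow> real^'p"
  assumes "T > 0"
    and "CARD('m) \<le> CARD('n)" and "CARD('p) \<le> CARD('n)"
    and "rank C = CARD('p)"
    and "continuous_embedding T emb"
    and "output_map_continuous T A B C emb"
    and "output_tracking_observable T A B C emb"
  shows "\<forall>f::'y. \<exists>u_min.
           is_arg_min (L2_norm T) (tracking_control T A B C emb f) u_min \<and>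
           (\<forall>w. is_arg_min (L2_norm T) (tracking_control T A B C emb f) w \<longrightarrow>
              (AE t in time_measure T. w t = u_min t)) \<and>
           (\<exists>g_hat.
              is_arg_min (dual_functional T A B C emb f) (\<lambda>g. True) g_hat \<and>
              (\<forall>g. is_arg_min (dual_functional T A B C emb f) (\<lambda>g. True) g \<longrightarrow> g = g_hat) \<and>
              (\<exists>\<phi>. adjoint_solution T A B C emb g_hat \<phi>) \<and>
              (\<forall>\<phi>. adjoint_solution T A B C emb g_hat \<phi> \<longrightarrow>
                 (AE t in time_measure T. u_min t = transpose B *v \<phi> t)))"
proof
  fix f :: 'y
  interpret observable_tracking_system T A B C emb
    using assms by unfold_locales
  obtain g_hat where g_hat: "gramian g_hat = f" using gramian_surjective by blast
  define u_min where "u_min = adjoint_output g_hat"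
  have u_min: "u_min \<in> L2 T" and u_min_output: "trajectory u_min = f"
    using g_hat by (simp_all add: u_min_def adjoint_output_L2 gramian_def)
  \<comment> \<open>Orthogonality: \<open>\<langle>\<Lambda>\<^sup>* g_hat, w\<rangle> = g_hat (\<Lambda> w)\<close> has the same value \<open>g_hat f\<close> for all tracking controls \<open>w\<close>.\<close>
  have pythagoras: "(L2_norm T w)\<^sup>2 = (L2_norm T u_min)\<^sup>2 + (L2_norm T (\<lambda>t. w t - u_min t))\<^sup>2"
    if w: "w \<in> L2 T" "trajectory w = f" for w
  proof -
    have "L2_inner T u_min w = L2_inner T u_min u_min"
      unfolding u_min_def using w u_min_output u_min by (simp add: L2_inner_adjoint_output u_min_def)
    then show ?thesis
      using L2_norm_square_diff[OF w(1) u_min] by (simp add: L2_inner_commute[of T w u_min] L2_norm_square)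
  qed
  have dual: "dual_functional T A B C emb f g
      = dual_functional T A B C emb f g_hat + (L2_norm T (adjoint_output (g - g_hat)))\<^sup>2 / 2" for g
    using dual_functional_shift[of f g_hat 1 "g - g_hat"] g_hat by simp
  obtain \<gamma> where \<gamma>: "\<And>g. (norm g)\<^sup>2 \<le> \<gamma> * (L2_norm T (adjoint_output g))\<^sup>2"
    using observability by blast
  have "is_arg_min (L2_norm T) (tracking_control T A B C emb f) u_min"
  proof -
    have "L2_norm T u_min \<le> L2_norm T w" if "w \<in> L2 T" "trajectory w = f" for w
      by (rule power2_le_imp_le) (simp_all add: pythagoras[OF that] L2_norm_nonneg)
    then show ?thesis
      using u_min u_min_output by (auto simp: is_arg_min_linorder tracking_control_iff)
  qed
  moreover have "AE t in time_measure T. w t = u_min t"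
    if "is_arg_min (L2_norm T) (tracking_control T A B C emb f) w" for w
  proof -
    have w: "w \<in> L2 T" "trajectory w = f" "L2_norm T w \<le> L2_norm T u_min"
      using that u_min u_min_output by (auto simp: is_arg_min_linorder tracking_control_iff)
    have "(L2_norm T (\<lambda>t. w t - u_min t))\<^sup>2 \<le> 0"
      using power_mono[OF w(3) L2_norm_nonneg, of 2] pythagoras[OF w(1,2)] by simp
    then have "L2_norm T (\<lambda>t. w t - u_min t) = 0" by simp
    then show ?thesis using L2_norm_zero_iff[OF L2_diff[OF w(1) u_min]] by simp
  qed
  moreover have "is_arg_min (dual_functional T A B C emb f) (\<lambda>g. True) g_hat"
  proof -
    have "dual_functional T A B C emb f g_hat \<le> dual_functional T A B C emb f g" for g
      using dual[of g] by simp
    then show ?thesis by (simp add: is_arg_min_linorder)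
  qed
  moreover have "g = g_hat" if "is_arg_min (dual_functional T A B C emb f) (\<lambda>g. True) g" for g
  proof -
    have "dual_functional T A B C emb f g \<le> dual_functional T A B C emb f g_hat"
      using that by (simp add: is_arg_min_linorder)
    then have "(L2_norm T (adjoint_output (g - g_hat)))\<^sup>2 \<le> 0" using dual[of g] by simp
    then have "(norm (g - g_hat))\<^sup>2 \<le> 0" using \<gamma>[of "g - g_hat"] by simp
    then show ?thesis by simp
  qed
  moreover have "AE t in time_measure T. u_min t = transpose B *v \<phi> t"
    if "adjoint_solution T A B C emb g_hat \<phi>" for \<phi>
    unfolding u_min_def by (rule observation_adjoint_solution[OF that])
  ultimately show "\<exists>u_min.
           is_arg_min (L2_norm T) (tracking_control T A B C emb f) u_min \<and>
           (\<forall>w. is_arg_min (L2_norm T) (tracking_control T A B C emb f) w \<longrightarrow>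
              (AE t in time_measure T. w t = u_min t)) \<and>
           (\<exists>g_hat.
              is_arg_min (dual_functional T A B C emb f) (\<lambda>g. True) g_hat \<and>
              (\<forall>g. is_arg_min (dual_functional T A B C emb f) (\<lambda>g. True) g \<longrightarrow> g = g_hat) \<and>
              (\<exists>\<phi>. adjoint_solution T A B C emb g_hat \<phi>) \<and>
              (\<forall>\<phi>. adjoint_solution T A B C emb g_hat \<phi> \<longrightarrow>
                 (AE t in time_measure T. u_min t = transpose B *v \<phi> t)))"
    using adjoint_solution_exists[of g_hat] by blast
qed

end
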